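(* In the setting described in the context, let $\theta_i\neq 0$ ($i\in[n-1]$) and $\zeta_j\ne 0$ ($j\in[m]$). (i) If $(z_i^\star,s_j^\star)_{i\in[n-1],j\in[m]}\in\mathrm{Fix}\,\mathcal T_{zs,\theta,\zeta}$, then $(u_0^\star,(u_i^\star)_{i\in[n-1]},(z_i^\star)_{i\in[n-1]},(s_j^\star)_{j\in[m]})\in\mathrm{Fix}\,\mathcal T_{uzs,\theta,\zeta}$, where for all $i\in[n-1]$ $$u_0^\star=u_i^\star=J_{A_0}^{\sum_{c\in\mathrm{ch}(0)}M_c}\Big(\sum_{c\in\mathrm{ch}(0)}M_cz_c^\star-\sum_{j\in\mathcal J_0}L_j^*s_j^\star+a\Big),$$ and $u_0^\star$ solves (P). (ii) If $u^\star$ is a solution to (P), then there exist $(s_j^\star)_{j\in[m]}\in\prod_{j=1}^m\mathcal K_j$ and $(w_i^\star)_{i\in[n-1]}\in\mathcal H^{n-1}$ such that $(u_0^\star,(u_i^\star)_i,(u_0^\star-w_i^\star)_i,(s_j^\star)_j)\in\mathrm{Fix}\,\mathcal T_{uzs,\theta,\zeta}$, where $u_0^\star=u_i^\star=u^\star$ for all $i\in[n-1]$, and $((u^\star-w_i^\star)_i,(s_j^\star)_j)\in\mathrm{Fix}\,\mathcal T_{zs,\theta,\zeta}$.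
   Context: Notation: $[r]=\{1,\dots,r\}$. For $M$ bounded, self-adjoint, uniformly positive definite and $A$ maximally monotone, $J_A^M:=J_{M^{-1}A}\circ M^{-1}=(M+A)^{-1}$ (single-valued, full domain). $\mathrm{Fix}\,T$ is the fixed point set of $T$. Problem data: $n\ge2$ and $m,p\ge0$ are integers; $\mathcal H,\mathcal K_1,\dots,\mathcal K_m$ are real Hilbert spaces; $A_i:\mathcal H\to2^{\mathcal H}$ ($i=0,\dots,n-1$) and $B_j:\mathcal K_j\to2^{\mathcal K_j}$ are maximally monotone; $D_j:\mathcal K_j\to2^{\mathcal K_j}$ is maximally monotone and $\nu_j$-strongly monotone, $\nu_j>0$ (so $D_j^{-1}$ is single-valued and $\nu_j$-cocoercive); $C_l:\mathcal H\to\mathcal H$ ($l\in[p]$) is $\beta_l$-cocoercive, $\beta_l>0$; $L_j:\mathcal H\to\mathcal K_j$ is bounded linear; $a\in\mathcal H$, $b_j\in\mathcal K_j$. Problem (P): find $u\in\mathcal H$ with $a\in\sum_{i=0}^{n-1}A_iu+\sum_{j=1}^mL_j^*(B_j\square D_j)(L_ju-b_j)+\sum_{l=1}^pC_lu$, where $B\square D=(B^{-1}+D^{-1})^{-1}$. Tree data: an arbitrary rooted tree with node set $\{0,\dots,n-1\}$ and root $0$; $\mathrm{pa}(i)$ is the parent of $i\in[n-1]$, $\mathrm{ch}(i)$ the set of children of $i$. $(\mathcal J_i)_{i=0}^{n-1}$ is a partition of $[m]$ (empty cells allowed) with $\mathcal J_i=\varnothing$ for every leaf $i$. $(\mathcal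 P_i)_{i=0}^{n-1}$ is a partition of $[p]$ (empty cells allowed) with $\mathcal P_0=\varnothing$. For each non-leaf node $r$, $(\mathcal J_{c,i})_{i\in\mathrm{ch}(r)}$ is a partition (empty cells allowed) of $\mathcal J_r$. All choices are otherwise arbitrary. Metrics: $M_i:\mathcal H\to\mathcal H$ ($i\in[n-1]$) and $N_j:\mathcal K_j\to\mathcal K_j$ ($j\in[m]$) are linear, bounded, self-adjoint, uniformly positive definite. Prediction maps: given $(z,s)=((z_i)_{i\in[n-1]},(s_j)_{j\in[m]})$, compute from root to leaves $u_0,\dots,u_{n-1}$, $\tilde s_j$, $\tilde z_i$ by (root) $0\in A_0u_0+\sum_{c\in\mathrm{ch}(0)}M_c(u_0-z_c)+\sum_{j\in\mathcal J_0}L_j^*s_j-a$; (duals, for each node $i$ and each $j\in\mathcal J_i$) $0\in B_j^{-1}\tilde s_j+N_j(\tilde s_j-s_j)+D_j^{-1}s_j-L_ju_i+b_j$; (nodes $i\in[n-1]$) $0\in A_iu_i+M_i(u_i+z_i-2u_{\mathrm{pa}(i)})+\sum_{c\in\mathrm{ch}(i)}M_c(u_i-z_c)+\sum_{l\in\mathcal P_i}C_lu_{\mathrm{pa}(i)}+\sum_{j\in\mathcal J_i}L_j^*s_j+\sum_{j\in\mathcal J_{c,i}}L_j^*(\tilde s_j-s_j)$; $\tilde z_i=z_i+u_i-u_{\mathrm{pa}(i)}$. All quantities are uniquely defined. Put $\mathcal T_{zs}(z,s)=(\tilde z,\tilde s)$ on $\mathcal H^{n-1}\times\prod_j\mathcal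 K_j$, and $\mathcal T_{uzs}(v_0,(v_i)_i,z,s)=(u_0,(u_i)_i,\tilde z,\tilde s)$ on $\mathcal H\times\mathcal H^{n-1}\times\mathcal H^{n-1}\times\prod_j\mathcal K_j$ (the input $v$'s are not used). Relaxed maps: $\mathcal T_{zs,\theta,\zeta}(z,s)=(z^+,s^+)$ with $z_i^+=z_i+\theta_i(\tilde z_i-z_i)$, $s_j^+=s_j+\zeta_j(\tilde s_j-s_j)$; $\mathcal T_{uzs,\theta,\zeta}(v_0,(v_i)_i,z,s)=(u_0,(u_i)_i,z^+,s^+)$. *)

theory Defs
  imports "HOL-Analysis.Analysis" "HOL-Library.Set_Algebras" "HOL-Library.FuncSet"
begin

section \<open>Set-valued operators\<close>

text \<open>
  An operator \<open>A : X \<rightarrow> 2\<^sup>X\<close> is a function \<open>'a \<Rightarrow> 'a set\<close>. The ambient space \<open>X\<close> is a carrier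
  set, so that operators on a closed subspace of a Hilbert space are covered: outside of \<open>X\<close> they
  have empty values. Sums of sets are Minkowski sums; in particular an empty sum of sets is \<open>{0}\<close>.
\<close>

definition operator_on :: "'a set \<Rightarrow> ('a \<Rightarrow> 'a set) \<Rightarrow> bool" where
  "operator_on X A \<longleftrightarrow> (\<forall>x. \<forall>u\<in>A x. x \<in> X \<and> u \<in> X)"

definition monotone_operator :: "('a::real_inner \<Rightarrow> 'a set) \<Rightarrow> bool" where
  "monotone_operator A \<longleftrightarrow> (\<forall>x y. \<forall>u\<in>A x. \<forall>v\<in>A y. 0 \<le> (x - y) \<bullet> (u - v))"

definition maximally_monotone_on :: "'a::real_inner set \<Rightarrow> ('a \<Rightarrow> 'a set) \<Rightarrow> bool" where
  "maximally_monotone_on X A \<longleftrightarrow>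
     operator_on X A \<and> monotone_operator A \<and>
     (\<forall>A'. operator_on X A' \<and> monotone_operator A' \<and> (\<forall>x. A x \<subseteq> A' x) \<longrightarrow> A' = A)"

definition strongly_monotone :: "real \<Rightarrow> ('a::real_inner \<Rightarrow> 'a set) \<Rightarrow> bool" where
  "strongly_monotone \<nu> A \<longleftrightarrow>
     (\<forall>x y. \<forall>u\<in>A x. \<forall>v\<in>A y. \<nu> * (norm (x - y))\<^sup>2 \<le> (x - y) \<bullet> (u - v))"

definition cocoercive :: "real \<Rightarrow> ('a::real_inner \<Rightarrow> 'a) \<Rightarrow> bool" where
  "cocoercive \<beta> C \<longleftrightarrow> (\<forall>x y. \<beta> * (norm (C x - C y))\<^sup>2 \<le> (x - y) \<bullet> (C x - C y))"

definition inverse_op :: "('a \<Rightarrow> 'a set) \<Rightarrow> 'a \<Rightarrow> 'a set" where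
  "inverse_op A u = {x. u \<in> A x}"

definition parallel_sum :: "('a::plus \<Rightarrow> 'a set) \<Rightarrow> ('a \<Rightarrow> 'a set) \<Rightarrow> 'a \<Rightarrow> 'a set" where
  "parallel_sum B D = inverse_op (\<lambda>u. inverse_op B u + inverse_op D u)"

text \<open>Bounded, linear, self-adjoint, uniformly positive definite maps of a subspace \<open>X\<close> into itself.\<close>

definition metric_on :: "'a::real_inner set \<Rightarrow> ('a \<Rightarrow> 'a) \<Rightarrow> bool" where
  "metric_on X M \<longleftrightarrow>
     (\<forall>x\<in>X. M x \<in> X) \<and>
     (\<forall>x\<in>X. \<forall>y\<in>X. M (x + y) = M x + M y) \<and>
     (\<forall>c. \<forall>x\<in>X. M (c *\<^sub>R x) = c *\<^sub>R M x) \<and>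
     (\<exists>K. \<forall>x\<in>X. norm (M x) \<le> K * norm x) \<and>
     (\<forall>x\<in>X. \<forall>y\<in>X. M x \<bullet> y = x \<bullet> M y) \<and>
     (\<exists>\<mu>>0. \<forall>x\<in>X. \<mu> * (norm x)\<^sup>2 \<le> M x \<bullet> x)"

lemma metric_on_UNIV:
  "metric_on UNIV M \<longleftrightarrow>
     bounded_linear M \<and> (\<forall>x y. M x \<bullet> y = x \<bullet> M y) \<and> (\<exists>\<mu>>0. \<forall>x. \<mu> * (norm x)\<^sup>2 \<le> M x \<bullet> x)"
  by (simp add: metric_on_def bounded_linear_def bounded_linear_axioms_def linear_iff mult.commute
      conj_assoc)

definition resolvent :: "('a::real_inner \<Rightarrow> 'a set) \<Rightarrow> 'a \<Rightarrow> 'a" where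
  "resolvent A x = (THE u. x \<in> {u} + A u)"

text \<open>\<open>J\<^sub>A\<^sup>M\<close>, the resolvent of \<open>M\<^sup>-\<^sup>1 A\<close> applied after \<open>M\<^sup>-\<^sup>1\<close>.\<close>

definition metric_resolvent :: "('a::real_inner \<Rightarrow> 'a) \<Rightarrow> ('a \<Rightarrow> 'a set) \<Rightarrow> 'a \<Rightarrow> 'a" where
  "metric_resolvent M A = resolvent (\<lambda>u. inv M ` A u) \<circ> inv M"

lemma metric_resolvent_eq:
  assumes "linear M" and "bij M"
  shows "metric_resolvent M A x = (THE u. x \<in> {M u} + A u)"
proof -
  have "inv M x \<in> {u} + inv M ` A u \<longleftrightarrow> x \<in> {M u} + A u" for u
  proof -
    have "inv M x = u + inv M v \<longleftrightarrow> x = M u + v" for v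
    proof -
      have "inv M x = u + inv M v \<longleftrightarrow> x = M (u + inv M v)"
        using bij_inv_eq_iff[OF assms(2), of "u + inv M v" x] by auto
      also have "M (u + inv M v) = M u + v"
        using bij_is_surj[OF assms(2)] linear_add[OF assms(1)] by (simp add: surj_f_inv_f)
      finally show ?thesis .
    qed
    then show ?thesis by (auto simp: set_plus_def)
  qed
  then show ?thesis by (simp add: metric_resolvent_def resolvent_def)
qed

definition Fix :: "'s set \<Rightarrow> ('s \<Rightarrow> 's) \<Rightarrow> 's set" where
  "Fix S T = {x \<in> S. T x = x}"


section \<open>Problem data\<close>

text \<open>
  \<open>\<H>\<close> is the type \<open>'h\<close>, of class \<open>real_inner\<close> and \<open>complete_space\<close>. A type cannot depend on the
  index \<open>j\<close>, so the Hilbert spaces \<open>\<K>\<^sub>1, \<dots>, \<K>\<^sub>m\<close> are complete subspaces \<open>spK j\<close> of one inner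
  product space \<open>'k\<close>. Arbitrary Hilbert spaces \<open>\<K>\<^sub>1, \<dots>, \<K>\<^sub>m\<close> are of this form, by taking for \<open>'k\<close>
  their finite direct sum.
\<close>

record ('h, 'k) problem =
  numA :: nat
  numB :: nat
  numC :: nat
  spK :: "nat \<Rightarrow> 'k set"
  opA :: "nat \<Rightarrow> 'h \<Rightarrow> 'h set"
  opB :: "nat \<Rightarrow> 'k \<Rightarrow> 'k set"
  opD :: "nat \<Rightarrow> 'k \<Rightarrow> 'k set"
  modD :: "nat \<Rightarrow> real"
  opC :: "nat \<Rightarrow> 'h \<Rightarrow> 'h"
  modC :: "nat \<Rightarrow> real"
  opL :: "nat \<Rightarrow> 'h \<Rightarrow> 'k"
  vecA :: 'h
  vecB :: "nat \<Rightarrow> 'k"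

definition valid_problem ::
    "('h::{real_inner,complete_space}, 'k::real_inner) problem \<Rightarrow> bool" where
  "valid_problem Q \<longleftrightarrow>
     numA Q \<ge> 2 \<and>
     (\<forall>j\<in>{1..numB Q}. subspace (spK Q j) \<and> complete (spK Q j)) \<and>
     (\<forall>i<numA Q. maximally_monotone_on UNIV (opA Q i)) \<and>
     (\<forall>j\<in>{1..numB Q}. maximally_monotone_on (spK Q j) (opB Q j)) \<and>
     (\<forall>j\<in>{1..numB Q}. maximally_monotone_on (spK Q j) (opD Q j) \<and>
        modD Q j > 0 \<and> strongly_monotone (modD Q j) (opD Q j)) \<and>
     (\<forall>l\<in>{1..numC Q}. modC Q l > 0 \<and> cocoercive (modC Q l) (opC Q l)) \<and>
     (\<forall>j\<in>{1..numB Q}. bounded_linear (opL Q j) \<and> range (opL Q j) \<subseteq> spK Q j) \<and>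
     (\<forall>j\<in>{1..numB Q}. vecB Q j \<in> spK Q j)"

text \<open>
  \<open>L\<^sub>j\<close> has range in \<open>\<K>\<^sub>j\<close>, so its adjoint as a map into \<open>\<K>\<^sub>j\<close> is the restriction to \<open>\<K>\<^sub>j\<close> of the
  library's \<open>adjoint (opL Q j)\<close>, which is only ever applied to elements of \<open>\<K>\<^sub>j\<close> below.
\<close>

definition solves :: "('h::real_inner, 'k::real_inner) problem \<Rightarrow> 'h \<Rightarrow> bool" where
  "solves Q u \<longleftrightarrow>
     vecA Q \<in> (\<Sum>i<numA Q. opA Q i u)
            + (\<Sum>j\<in>{1..numB Q}.
                 adjoint (opL Q j) ` parallel_sum (opB Q j) (opD Q j) (opL Q j u - vecB Q j))
            + {\<Sum>l\<in>{1..numC Q}. opC Q l u}"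


section \<open>Tree data\<close>

text \<open>Unlike in \<open>partition_on\<close>, cells are indexed and may be empty.\<close>

definition cells_partition :: "'i set \<Rightarrow> ('i \<Rightarrow> 'b set) \<Rightarrow> 'b set \<Rightarrow> bool" where
  "cells_partition I F S \<longleftrightarrow> (\<Union>i\<in>I. F i) = S \<and> disjoint_family_on F I"

text \<open>
  A rooted tree with nodes \<open>{..<n}\<close> and root \<open>0\<close> is given by the parent of each node other than the
  root, every node having the root as an ancestor. The labelling of the nodes is arbitrary; neither
  \<open>pa i < i\<close> nor anything about the irrelevant value \<open>pa 0\<close> is assumed.
\<close>

definition rooted_tree :: "nat \<Rightarrow> (nat \<Rightarrow> nat) \<Rightarrow> bool" where
  "rooted_tree n pa \<longleftrightarrow>
     (\<forall>i\<in>{1..<n}. pa i < n) \<and>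
     (\<forall>i<n. (i, 0) \<in> {(c, pa c) | c. c \<in> {1..<n}}\<^sup>*)"

text \<open>
  The fields are \<open>pa\<close>, \<open>(\<J>\<^sub>i)\<close>, \<open>(\<P>\<^sub>i)\<close> and \<open>(\<J>\<^sub>c\<^sub>,\<^sub>i)\<close>. Every node \<open>i \<noteq> 0\<close> is a child of exactly one
  node, so the partitions \<open>(\<J>\<^sub>c\<^sub>,\<^sub>i)\<close> indexed by \<open>i \<in> ch(r)\<close>, for all non-leaf nodes \<open>r\<close>, make up a
  single family over the nodes \<open>i \<noteq> 0\<close>.
\<close>

record tree_data =
  pa :: "nat \<Rightarrow> nat"
  cellJ :: "nat \<Rightarrow> nat set"
  cellP :: "nat \<Rightarrow> nat set"
  cellJc :: "nat \<Rightarrow> nat set"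

definition ch :: "('h, 'k) problem \<Rightarrow> tree_data \<Rightarrow> nat \<Rightarrow> nat set" where
  "ch Q G r = {i \<in> {1..<numA Q}. pa G i = r}"

definition valid_tree :: "('h, 'k) problem \<Rightarrow> tree_data \<Rightarrow> bool" where
  "valid_tree Q G \<longleftrightarrow>
     rooted_tree (numA Q) (pa G) \<and>
     cells_partition {..<numA Q} (cellJ G) {1..numB Q} \<and>
     (\<forall>i<numA Q. ch Q G i = {} \<longrightarrow> cellJ G i = {}) \<and>
     cells_partition {..<numA Q} (cellP G) {1..numC Q} \<and>
     cellP G 0 = {} \<and>
     (\<forall>r<numA Q. ch Q G r \<noteq> {} \<longrightarrow> cells_partition (ch Q G r) (cellJc G) (cellJ G r))"

definition valid_metrics ::
    "('h::real_inner, 'k::real_inner) problem \<Rightarrow> (nat \<Rightarrow> 'h \<Rightarrow> 'h) \<Rightarrow> (nat \<Rightarrow> 'k \<Rightarrow> 'k) \<Rightarrow> bool" where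
  "valid_metrics Q M N \<longleftrightarrow>
     (\<forall>i\<in>{1..<numA Q}. metric_on UNIV (M i)) \<and>
     (\<forall>j\<in>{1..numB Q}. metric_on (spK Q j) (N j))"


section \<open>Prediction maps and relaxed maps\<close>

text \<open>
  Families indexed by \<open>[n-1] = {1..<n}\<close> or \<open>[m] = {1..m}\<close> are extensional functions, so that
  equality of families is equality at every index.
\<close>

abbreviation H_fam :: "('h, 'k) problem \<Rightarrow> (nat \<Rightarrow> 'h) set" where
  "H_fam Q \<equiv> {1..<numA Q} \<rightarrow>\<^sub>E UNIV"

abbreviation K_fam :: "('h, 'k) problem \<Rightarrow> (nat \<Rightarrow> 'k) set" where
  "K_fam Q \<equiv> \<Pi>\<^sub>E j\<in>{1..numB Q}. spK Q j"

definition space_zs :: "('h, 'k) problem \<Rightarrow> ((nat \<Rightarrow> 'h) \<times> (nat \<Rightarrow> 'k)) set" where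
  "space_zs Q = H_fam Q \<times> K_fam Q"

definition space_uzs ::
    "('h, 'k) problem \<Rightarrow> ('h \<times> (nat \<Rightarrow> 'h) \<times> (nat \<Rightarrow> 'h) \<times> (nat \<Rightarrow> 'k)) set" where
  "space_uzs Q = UNIV \<times> H_fam Q \<times> H_fam Q \<times> K_fam Q"

definition is_prediction ::
    "('h::real_inner, 'k::real_inner) problem \<Rightarrow> tree_data \<Rightarrow> (nat \<Rightarrow> 'h \<Rightarrow> 'h) \<Rightarrow> (nat \<Rightarrow> 'k \<Rightarrow> 'k) \<Rightarrow>
     (nat \<Rightarrow> 'h) \<Rightarrow> (nat \<Rightarrow> 'k) \<Rightarrow> (nat \<Rightarrow> 'h) \<Rightarrow> (nat \<Rightarrow> 'h) \<Rightarrow> (nat \<Rightarrow> 'k) \<Rightarrow> bool" where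
  "is_prediction Q G M N z s u zt st \<longleftrightarrow>
     u \<in> {..<numA Q} \<rightarrow>\<^sub>E UNIV \<and> zt \<in> H_fam Q \<and> st \<in> K_fam Q \<and>
     0 \<in> opA Q 0 (u 0)
         + {(\<Sum>c\<in>ch Q G 0. M c (u 0 - z c))
            + (\<Sum>j\<in>cellJ G 0. adjoint (opL Q j) (s j)) - vecA Q} \<and>
     (\<forall>i<numA Q. \<forall>j\<in>cellJ G i.
        0 \<in> inverse_op (opB Q j) (st j) + {N j (st j - s j)} + inverse_op (opD Q j) (s j)
            + {- opL Q j (u i) + vecB Q j}) \<and>
     (\<forall>i\<in>{1..<numA Q}.
        0 \<in> opA Q i (u i)
            + {M i (u i + z i - 2 *\<^sub>R u (pa G i))
               + (\<Sum>c\<in>ch Q G i. M c (u i - z c))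
               + (\<Sum>l\<in>cellP G i. opC Q l (u (pa G i)))
               + (\<Sum>j\<in>cellJ G i. adjoint (opL Q j) (s j))
               + (\<Sum>j\<in>cellJc G i. adjoint (opL Q j) (st j - s j))}) \<and>
     (\<forall>i\<in>{1..<numA Q}. zt i = z i + u i - u (pa G i))"

text \<open>
  Computing from the root to the leaves: node \<open>i\<close> involves only \<open>u (pa i)\<close>, and \<open>st j\<close> for
  \<open>j \<in> \<J>\<^sub>c\<^sub>,\<^sub>i\<close>, which is determined at the node \<open>pa i\<close>. Each step is the evaluation of a
  resolvent, so for valid data the system has exactly one solution.
\<close>

definition prediction ::
    "('h::real_inner, 'k::real_inner) problem \<Rightarrow> tree_data \<Rightarrow> (nat \<Rightarrow> 'h \<Rightarrow> 'h) \<Rightarrow> (nat \<Rightarrow> 'k \<Rightarrow> 'k) \<Rightarrow>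
     (nat \<Rightarrow> 'h) \<times> (nat \<Rightarrow> 'k) \<Rightarrow> (nat \<Rightarrow> 'h) \<times> (nat \<Rightarrow> 'h) \<times> (nat \<Rightarrow> 'k)" where
  "prediction Q G M N = (\<lambda>(z, s). THE (u, zt, st). is_prediction Q G M N z s u zt st)"

definition T_zs ::
    "('h::real_inner, 'k::real_inner) problem \<Rightarrow> tree_data \<Rightarrow> (nat \<Rightarrow> 'h \<Rightarrow> 'h) \<Rightarrow> (nat \<Rightarrow> 'k \<Rightarrow> 'k) \<Rightarrow>
     (nat \<Rightarrow> 'h) \<times> (nat \<Rightarrow> 'k) \<Rightarrow> (nat \<Rightarrow> 'h) \<times> (nat \<Rightarrow> 'k)" where
  "T_zs Q G M N x = (case prediction Q G M N x of (u, zt, st) \<Rightarrow> (zt, st))"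

definition T_uzs ::
    "('h::real_inner, 'k::real_inner) problem \<Rightarrow> tree_data \<Rightarrow> (nat \<Rightarrow> 'h \<Rightarrow> 'h) \<Rightarrow> (nat \<Rightarrow> 'k \<Rightarrow> 'k) \<Rightarrow>
     'h \<times> (nat \<Rightarrow> 'h) \<times> (nat \<Rightarrow> 'h) \<times> (nat \<Rightarrow> 'k) \<Rightarrow>
     'h \<times> (nat \<Rightarrow> 'h) \<times> (nat \<Rightarrow> 'h) \<times> (nat \<Rightarrow> 'k)" where
  "T_uzs Q G M N = (\<lambda>(v\<^sub>0, v, z, s).
     case prediction Q G M N (z, s) of (u, zt, st) \<Rightarrow> (u 0, restrict u {1..<numA Q}, zt, st))"

definition relax ::
    "('h::real_vector, 'k::real_vector) problem \<Rightarrow> (nat \<Rightarrow> real) \<Rightarrow> (nat \<Rightarrow> real) \<Rightarrow>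
     (nat \<Rightarrow> 'h) \<times> (nat \<Rightarrow> 'k) \<Rightarrow> (nat \<Rightarrow> 'h) \<times> (nat \<Rightarrow> 'k) \<Rightarrow> (nat \<Rightarrow> 'h) \<times> (nat \<Rightarrow> 'k)" where
  "relax Q \<theta> \<zeta> = (\<lambda>(z, s) (zt, st).
     ((\<lambda>i\<in>{1..<numA Q}. z i + \<theta> i *\<^sub>R (zt i - z i)),
      (\<lambda>j\<in>{1..numB Q}. s j + \<zeta> j *\<^sub>R (st j - s j))))"

definition T_zs_relaxed ::
    "('h::real_inner, 'k::real_inner) problem \<Rightarrow> tree_data \<Rightarrow> (nat \<Rightarrow> 'h \<Rightarrow> 'h) \<Rightarrow> (nat \<Rightarrow> 'k \<Rightarrow> 'k) \<Rightarrow>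
     (nat \<Rightarrow> real) \<Rightarrow> (nat \<Rightarrow> real) \<Rightarrow>
     (nat \<Rightarrow> 'h) \<times> (nat \<Rightarrow> 'k) \<Rightarrow> (nat \<Rightarrow> 'h) \<times> (nat \<Rightarrow> 'k)" where
  "T_zs_relaxed Q G M N \<theta> \<zeta> x = relax Q \<theta> \<zeta> x (T_zs Q G M N x)"

definition T_uzs_relaxed ::
    "('h::real_inner, 'k::real_inner) problem \<Rightarrow> tree_data \<Rightarrow> (nat \<Rightarrow> 'h \<Rightarrow> 'h) \<Rightarrow> (nat \<Rightarrow> 'k \<Rightarrow> 'k) \<Rightarrow>
     (nat \<Rightarrow> real) \<Rightarrow> (nat \<Rightarrow> real) \<Rightarrow>
     'h \<times> (nat \<Rightarrow> 'h) \<times> (nat \<Rightarrow> 'h) \<times> (nat \<Rightarrow> 'k) \<Rightarrow>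
     'h \<times> (nat \<Rightarrow> 'h) \<times> (nat \<Rightarrow> 'h) \<times> (nat \<Rightarrow> 'k)" where
  "T_uzs_relaxed Q G M N \<theta> \<zeta> = (\<lambda>(v\<^sub>0, v, z, s).
     case T_uzs Q G M N (v\<^sub>0, v, z, s) of
       (u\<^sub>0, u, zt, st) \<Rightarrow> (u\<^sub>0, u, relax Q \<theta> \<zeta> (z, s) (zt, st)))"

end

theory Submission
  imports Defs
begin

text \<open>
  At a fixed point \<open>z\<^sub>i\<close> is unchanged, so \<open>u\<^sub>i = u\<^bsub>pa(i)\<^esub>\<close> and all \<open>u\<^sub>i\<close> agree with \<open>u\<^sub>0\<close>. The
  term \<open>g\<^sub>c = M\<^sub>c (u\<^sub>0 - z\<^sub>c)\<close> then occurs with opposite signs in the inclusions of \<open>c\<close> and of its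
  parent, so summing the inclusions over the tree leaves (P). Conversely, a decomposition of
  \<open>a\<close> witnessing (P) prescribes \<open>g\<^sub>i\<close> from the leaves to the root by the inclusions of the nodes
  \<open>i \<noteq> 0\<close>; the inclusion of the root is then the total sum minus the others.

  That the prediction maps are well defined rests on Minty's theorem. It is obtained by minimizing
  the Fitzpatrick function plus half the squared norm; strong convexity makes minimizing sequences
  Cauchy, so no weak compactness is needed. The Riesz representation, on which the existence of
  adjoints rests, comes from the same minimization.
\<close>

section \<open>Minty's theorem\<close>

text \<open>\<open>E\<close> plays the role of the epigraph of a closed convex function that may
  take infinite values. Adding half the squared norm makes it strongly convex, so a minimizer over
  \<open>E\<close> exists. The conclusion is its optimality condition: \<open>-p\<^sub>0\<close> is
  a subgradient at \<open>p\<^sub>0\<close>.\<close>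

lemma epigraph_regularized_minimizer:
  fixes E :: "('a::real_inner \<times> real) set"
  assumes "convex E" "closed E" "E \<noteq> {}" "complete X" "fst ` E \<subseteq> X"
    and bound: "\<And>p r. (p, r) \<in> E \<Longrightarrow> l \<le> r + (norm p)\<^sup>2 / 2"
  shows "\<exists>p\<^sub>0 r\<^sub>0. (p\<^sub>0, r\<^sub>0) \<in> E \<and> (\<forall>p r. (p, r) \<in> E \<longrightarrow> r\<^sub>0 \<le> r + p\<^sub>0 \<bullet> (p - p\<^sub>0))"
proof -
  define \<Phi> :: "'a \<times> real \<Rightarrow> real" where "\<Phi> = (\<lambda>x. snd x + (norm (fst x))\<^sup>2 / 2)"
  have \<Phi>_cont: "isCont \<Phi> x" for x
    unfolding \<Phi>_def by (intro continuous_intros) auto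
  define m where "m = Inf (\<Phi> ` E)"
  have bdd: "bdd_below (\<Phi> ` E)"
    using bound by (intro bdd_belowI[where m = l]) (force simp: \<Phi>_def)
  have m_le: "m \<le> \<Phi> x" if "x \<in> E" for x
    unfolding m_def by (rule cInf_lower) (use that bdd in auto)
  have "\<exists>x\<in>E. \<Phi> x < m + 1 / real (Suc k)" for k
    using cInf_lessD[of "\<Phi> ` E" "m + 1 / real (Suc k)"] assms(3) by (auto simp: m_def)
  then obtain x where x: "\<And>k. x k \<in> E" "\<And>k. \<Phi> (x k) < m + 1 / real (Suc k)"
    by metis
  have lim: "(\<lambda>k. \<Phi> (x k)) \<longlonglongrightarrow> m"
  proof (rule tendsto_sandwich)
    show "\<forall>\<^sub>F k in sequentially. m \<le> \<Phi> (x k)"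
      using x(1) m_le by simp
    show "\<forall>\<^sub>F k in sequentially. \<Phi> (x k) \<le> m + 1 / real (Suc k)"
      using x(2) by (intro always_eventually allI) (rule less_imp_le)
    show "(\<lambda>k. m + 1 / real (Suc k)) \<longlonglongrightarrow> m"
      using tendsto_add[OF tendsto_const[of m] LIMSEQ_Suc[OF lim_1_over_n]] by simp
  qed (rule tendsto_const)
  have conv: "(1 - t) *\<^sub>R a + t *\<^sub>R b \<in> E" if "a \<in> E" "b \<in> E" "0 \<le> t" "t \<le> 1" for a b t
    using convexD_alt[OF assms(1) that] .
  \<comment> \<open>Parallelogram law: at the midpoint \<open>\<Phi>\<close> is the mean of its two
    values minus an eighth of the squared distance, and the midpoint still lies in
    \<open>E\<close>.\<close>
  have mid: "(norm (fst a - fst b))\<^sup>2 \<le> 4 * (\<Phi> a - m) + 4 * (\<Phi> b - m)"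
    if "a \<in> E" "b \<in> E" for a b
  proof -
    have "m \<le> \<Phi> ((1 - 1/2) *\<^sub>R a + (1/2) *\<^sub>R b)"
      by (intro m_le conv that) auto
    then show ?thesis
      by (simp add: \<Phi>_def power2_norm_eq_inner inner_simps inner_commute field_simps)
  qed
  have "Cauchy (\<lambda>k. fst (x k))"
  proof (rule metric_CauchyI)
    fix e :: real assume "e > 0"
    \<comment> \<open>With \<open>e\<^sup>2 / 8\<close>, the two terms on the right of
      \<open>mid\<close> add up to less than \<open>e\<^sup>2\<close>.\<close>
    then have "\<forall>\<^sub>F k in sequentially. \<Phi> (x k) < m + e\<^sup>2 / 8"
      by (intro order_tendstoD(2)[OF lim]) simp
    then obtain K where K: "\<And>k. k \<ge> K \<Longrightarrow> \<Phi> (x k) < m + e\<^sup>2 / 8"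
      by (auto simp: eventually_sequentially)
    have "dist (fst (x i)) (fst (x j)) < e" if "i \<ge> K" "j \<ge> K" for i j
    proof -
      have "(norm (fst (x i) - fst (x j)))\<^sup>2 < e\<^sup>2"
        using mid[OF x(1)[of i] x(1)[of j]] K[OF that(1)] K[OF that(2)] by (simp add: field_simps)
      then show ?thesis
        using \<open>e > 0\<close> by (simp add: dist_norm power2_less_imp_less)
    qed
    then show "\<exists>K. \<forall>i\<ge>K. \<forall>j\<ge>K. dist (fst (x i)) (fst (x j)) < e" by blast
  qed
  moreover have "\<forall>k. fst (x k) \<in> X"
    using x(1) assms(5) by blast
  ultimately obtain p\<^sub>0 where p: "(\<lambda>k. fst (x k)) \<longlonglongrightarrow> p\<^sub>0"
    using assms(4) by (auto simp: complete_def)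
  define r\<^sub>0 where "r\<^sub>0 = m - (norm p\<^sub>0)\<^sup>2 / 2"
  \<comment> \<open>The values of \<open>\<Phi>\<close> and the norms both converge, hence so do the
    heights, and closedness of \<open>E\<close> applies to the pairs.\<close>
  have "(\<lambda>k. \<Phi> (x k) - (norm (fst (x k)))\<^sup>2 / 2) \<longlonglongrightarrow> r\<^sub>0"
    unfolding r\<^sub>0_def by (intro tendsto_intros lim p) auto
  then have "(\<lambda>k. (fst (x k), snd (x k))) \<longlonglongrightarrow> (p\<^sub>0, r\<^sub>0)"
    by (intro tendsto_Pair p) (simp add: \<Phi>_def)
  then have mem: "(p\<^sub>0, r\<^sub>0) \<in> E"
    using closed_sequentially[OF assms(2)] x(1) by auto
  have "r\<^sub>0 \<le> r + p\<^sub>0 \<bullet> (p - p\<^sub>0)" if "(p, r) \<in> E" for p r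
  proof -
    \<comment> \<open>A step of length \<open>t\<close> from the minimizer towards
      \<open>(p, r)\<close> cannot decrease \<open>\<Phi>\<close>. Dividing by \<open>t\<close> and
      letting \<open>t\<close> tend to 0 removes the quadratic term.\<close>
    have "0 \<le> (r - r\<^sub>0 + p\<^sub>0 \<bullet> (p - p\<^sub>0)) + t * ((norm (p - p\<^sub>0))\<^sup>2 / 2)" if t: "0 < t" "t \<le> 1" for t
    proof -
      have "m \<le> \<Phi> ((1 - t) *\<^sub>R (p\<^sub>0, r\<^sub>0) + t *\<^sub>R (p, r))"
        using t by (intro m_le conv mem \<open>(p, r) \<in> E\<close>) auto
      also have "\<dots> = m + t * ((r - r\<^sub>0 + p\<^sub>0 \<bullet> (p - p\<^sub>0)) + t * ((norm (p - p\<^sub>0))\<^sup>2 / 2))"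
        by (simp add: \<Phi>_def r\<^sub>0_def power2_norm_eq_inner inner_simps inner_commute field_simps)
      finally show ?thesis
        using t by (simp add: zero_le_mult_iff)
    qed
    then have ev: "\<forall>\<^sub>F t in at_right 0. 0 \<le> (r - r\<^sub>0 + p\<^sub>0 \<bullet> (p - p\<^sub>0)) + t * ((norm (p - p\<^sub>0))\<^sup>2 / 2)"
      by (auto simp: eventually_at_right_field intro!: exI[of _ 1])
    have lim: "((\<lambda>t. (r - r\<^sub>0 + p\<^sub>0 \<bullet> (p - p\<^sub>0)) + t * ((norm (p - p\<^sub>0))\<^sup>2 / 2))
        \<longlongrightarrow> (r - r\<^sub>0 + p\<^sub>0 \<bullet> (p - p\<^sub>0)) + 0 * ((norm (p - p\<^sub>0))\<^sup>2 / 2)) (at_right 0)"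
      by (intro tendsto_intros)
    from tendsto_lowerbound[OF lim ev] show ?thesis by simp
  qed
  with mem show ?thesis by blast
qed

section \<open>Riesz representation and the adjoint at zero\<close>

text \<open>The representing vector minimizes half the squared norm minus \<open>\<phi>\<close>.
  Optimality gives one inequality, and linearity turns it into an equality by passing to
  \<open>- x\<close>.\<close>

lemma riesz_representation:
  fixes \<phi> :: "'a::{real_inner,complete_space} \<Rightarrow> real"
  assumes "bounded_linear \<phi>"
  obtains p where "\<And>x. \<phi> x = x \<bullet> p"
proof -
  interpret bounded_linear \<phi> by fact
  obtain K where K: "\<And>x. norm (\<phi> x) \<le> norm x * K"
    using bounded by blast
  let ?E = "{(x, r). - \<phi> x \<le> r}"
  have E: "?E = {x. - \<phi> (fst x) \<le> snd x}" by auto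
  have closed: "closed ?E"
    unfolding E by (intro closed_Collect_le continuous_intros linear_continuous_on_compose
        continuous_on bounded_linear_axioms)
  have convex: "convex ?E"
  proof (rule convexI)
    fix p q :: "'a \<times> real" and u v :: real
    assume *: "p \<in> ?E" "q \<in> ?E" "0 \<le> u" "0 \<le> v"
    obtain x r y s where "p = (x, r)" "q = (y, s)" by fastforce
    with * show "u *\<^sub>R p + v *\<^sub>R q \<in> ?E"
      using mult_left_mono[of "- \<phi> x" r u] mult_left_mono[of "- \<phi> y" s v]
      by (simp add: add scaleR)
  qed
  \<comment> \<open>\<open>- (K\<^sup>2 / 2)\<close> is what remains after completing the square in
    \<open>norm x\<close>.\<close>
  have bound: "- (K\<^sup>2 / 2) \<le> r + (norm x)\<^sup>2 / 2" if "(x, r) \<in> ?E" for x r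
  proof -
    have "- (norm x * K) \<le> r"
      using that K[of x] by auto
    moreover have "0 \<le> (norm x - K)\<^sup>2" by simp
    ultimately show ?thesis
      by (simp add: power2_eq_square algebra_simps)
  qed
  have "(0, 0) \<in> ?E" by (simp add: zero)
  then have "?E \<noteq> {}" by blast
  then have "\<exists>p r. (p, r) \<in> ?E \<and> (\<forall>q s. (q, s) \<in> ?E \<longrightarrow> r \<le> s + p \<bullet> (q - p))"
    by (rule epigraph_regularized_minimizer[OF convex closed _ complete_UNIV subset_UNIV bound])
  then obtain p r where mem: "(p, r) \<in> ?E"
    and opt: "\<forall>q s. (q, s) \<in> ?E \<longrightarrow> r \<le> s + p \<bullet> (q - p)"
    by (elim exE conjE)
  \<comment> \<open>The optimality condition is tested at the boundary point of the epigraph of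
    \<open>- \<phi>\<close> above \<open>p + x\<close>.\<close>
  have le: "\<phi> x \<le> x \<bullet> p" for x
    using mem opt[rule_format, of "p + x" "- \<phi> (p + x)"] by (simp add: add inner_commute)
  have "\<phi> x = x \<bullet> p" for x
    using le[of x] le[of "- x"] by (simp add: neg)
  then show thesis by (rule that)
qed

text \<open>\<open>adjoint\<close> is a choice operator, so nothing is known about its value before
  some adjoint exists, which Riesz representation provides. At a fixed point the correction terms
  are \<open>adjoint\<close> applied to \<open>s j - s j\<close>, which this lemma cancels.\<close>

lemma adjoint_zero_hilbert:
  fixes L :: "'a::{real_inner,complete_space} \<Rightarrow> 'b::real_inner"
  assumes "bounded_linear L"
  shows "adjoint L 0 = 0"
proof -
  have "\<exists>p. \<forall>x. L x \<bullet> y = x \<bullet> p" for y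
    using riesz_representation[OF bounded_linear_compose[OF bounded_linear_inner_left assms]]
    by metis
  then obtain L' where "\<forall>x y. L x \<bullet> y = x \<bullet> L' y" by metis
  then have "\<forall>x y. L x \<bullet> y = x \<bullet> adjoint L y"
    unfolding adjoint_def by (rule someI[where P = "\<lambda>f. \<forall>x y. L x \<bullet> y = x \<bullet> f y"])
  then have "x \<bullet> adjoint L 0 = 0" for x
    using inner_zero_right by metis
  then show ?thesis
    using inner_eq_zero_iff by blast
qed

section \<open>Maximally monotone operators on a subspace\<close>

text \<open>A pair monotonically related to the whole graph can be inserted into it without losing
  monotonicity, so maximality forces the pair to be there already. Conversely, every pair of a
  monotone extension is related to the graph in this way.\<close>

lemma maximally_monotone_on_iff:
  "maximally_monotone_on X A \<longleftrightarrow>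
     operator_on X A \<and> monotone_operator A \<and>
     (\<forall>x\<in>X. \<forall>u\<in>X. (\<forall>y. \<forall>v\<in>A y. 0 \<le> (x - y) \<bullet> (u - v)) \<longrightarrow> u \<in> A x)"
  (is "?l \<longleftrightarrow> ?op \<and> ?mono \<and> ?max")
proof (intro iffI conjI)
  assume l: ?l
  then show op: ?op and mono: ?mono
    by (auto simp: maximally_monotone_on_def)
  show ?max
  proof (intro ballI impI)
    fix x u assume x: "x \<in> X" "u \<in> X" and rel: "\<forall>y. \<forall>v\<in>A y. 0 \<le> (x - y) \<bullet> (u - v)"
    let ?A = "A(x := insert u (A x))"
    have "0 \<le> (y - x) \<bullet> (v - u)" if "v \<in> A y" for y v
      using rel[rule_format, OF that] by (simp add: inner_diff algebra_simps)
    then have "monotone_operator ?A"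
      using mono rel by (fastforce simp: monotone_operator_def)
    moreover have "operator_on X ?A"
      using op x by (auto simp: operator_on_def)
    ultimately have "?A = A"
      using l unfolding maximally_monotone_on_def by auto
    then show "u \<in> A x"
      by (metis fun_upd_same insertI1)
  qed
next
  assume *: "?op \<and> ?mono \<and> ?max"
  have "A' x = A x"
    if A': "operator_on X A'" "monotone_operator A'" "\<forall>x. A x \<subseteq> A' x" for A' x
  proof
    show "A' x \<subseteq> A x"
    proof
      fix u assume u: "u \<in> A' x"
      then have "x \<in> X" "u \<in> X"
        using A'(1) by (auto simp: operator_on_def)
      moreover have "\<forall>y. \<forall>v\<in>A y. 0 \<le> (x - y) \<bullet> (u - v)"
        using A'(2,3) u by (force simp: monotone_operator_def)
      ultimately show "u \<in> A x" using * by blast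
    qed
  qed (use A' in auto)
  then show ?l
    using * by (auto simp: maximally_monotone_on_def)
qed

lemma maximally_monotone_onI:
  assumes "operator_on X A" "monotone_operator A"
    and "\<And>x u. x \<in> X \<Longrightarrow> u \<in> X \<Longrightarrow> (\<And>y v. v \<in> A y \<Longrightarrow> 0 \<le> (x - y) \<bullet> (u - v)) \<Longrightarrow> u \<in> A x"
  shows "maximally_monotone_on X A"
  using assms by (auto simp: maximally_monotone_on_iff)

lemma
  assumes "maximally_monotone_on X A"
  shows maximally_monotone_on_operator: "u \<in> A x \<Longrightarrow> x \<in> X \<and> u \<in> X"
    and maximally_monotone_on_mono: "u \<in> A x \<Longrightarrow> v \<in> A y \<Longrightarrow> 0 \<le> (x - y) \<bullet> (u - v)"
    and maximally_monotone_on_max: "x \<in> X \<Longrightarrow> u \<in> X \<Longrightarrow>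
      (\<And>y v. v \<in> A y \<Longrightarrow> 0 \<le> (x - y) \<bullet> (u - v)) \<Longrightarrow> u \<in> A x"
  using assms unfolding maximally_monotone_on_iff operator_on_def monotone_operator_def by blast+

lemma maximally_monotone_on_inverse_op:
  assumes "maximally_monotone_on X A"
  shows "maximally_monotone_on X (inverse_op A)"
proof (rule maximally_monotone_onI)
  show "operator_on X (inverse_op A)"
    using maximally_monotone_on_operator[OF assms] by (auto simp: operator_on_def inverse_op_def)
  show "monotone_operator (inverse_op A)"
    using maximally_monotone_on_mono[OF assms]
    by (auto simp: monotone_operator_def inverse_op_def inner_commute)
  show "u \<in> inverse_op A x"
    if "x \<in> X" "u \<in> X"
      and rel: "\<And>y v. v \<in> inverse_op A y \<Longrightarrow> 0 \<le> (x - y) \<bullet> (u - v)" for x u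
  proof -
    have "0 \<le> (u - y) \<bullet> (x - v)" if "v \<in> A y" for y v
      using rel[of y v] that by (simp add: inverse_op_def inner_commute)
    then have "x \<in> A u"
      by (intro maximally_monotone_on_max[OF assms] that(1,2))
    then show ?thesis by (simp add: inverse_op_def)
  qed
qed

text \<open>This is the operator \<open>\<gamma> A - w\<close>, written as a preimage. Its purpose:
  \<open>- x\<close> belongs to its value at \<open>x\<close> exactly when \<open>x\<close> is the
  resolvent of \<open>\<gamma> A\<close> at \<open>w\<close>.\<close>

lemma maximally_monotone_on_affine:
  assumes "maximally_monotone_on X A" "subspace X" "\<gamma> > 0" "w \<in> X"
  shows "maximally_monotone_on X (\<lambda>x. {u. (u + w) /\<^sub>R \<gamma> \<in> A x})"
proof (rule maximally_monotone_onI)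
  have "u \<in> X" if "(u + w) /\<^sub>R \<gamma> \<in> A x" for u x
  proof -
    have "\<gamma> *\<^sub>R ((u + w) /\<^sub>R \<gamma>) - w \<in> X"
      using maximally_monotone_on_operator[OF assms(1) that] assms(2,4)
      by (blast intro: subspace_diff subspace_mul)
    then show ?thesis using assms(3) by simp
  qed
  then show "operator_on X (\<lambda>x. {u. (u + w) /\<^sub>R \<gamma> \<in> A x})"
    using maximally_monotone_on_operator[OF assms(1)] by (auto simp: operator_on_def)
  \<comment> \<open>The shift by \<open>w\<close> cancels in differences and \<open>\<gamma>\<close>
    is a positive factor, so monotone relatedness transfers in both directions.\<close>
  have eq: "(x - y) \<bullet> (u - v) = \<gamma> * ((x - y) \<bullet> ((u + w) /\<^sub>R \<gamma> - (v + w) /\<^sub>R \<gamma>))" for x y u v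
    using assms(3) by (simp flip: scaleR_diff_right)
  show "monotone_operator (\<lambda>x. {u. (u + w) /\<^sub>R \<gamma> \<in> A x})"
    unfolding monotone_operator_def
  proof (intro allI ballI)
    fix x y u v
    assume "u \<in> {u. (u + w) /\<^sub>R \<gamma> \<in> A x}" "v \<in> {u. (u + w) /\<^sub>R \<gamma> \<in> A y}"
    then have "0 \<le> (x - y) \<bullet> ((u + w) /\<^sub>R \<gamma> - (v + w) /\<^sub>R \<gamma>)"
      by (intro maximally_monotone_on_mono[OF assms(1)]) simp_all
    then show "0 \<le> (x - y) \<bullet> (u - v)"
      unfolding eq[of x y u v] using assms(3) by (intro mult_nonneg_nonneg) simp_all
  qed
  show "u \<in> {u. (u + w) /\<^sub>R \<gamma> \<in> A x}"
    if "x \<in> X" "u \<in> X"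
      and rel: "\<And>y v. v \<in> {u. (u + w) /\<^sub>R \<gamma> \<in> A y} \<Longrightarrow> 0 \<le> (x - y) \<bullet> (u - v)" for x u
  proof -
    have "0 \<le> (x - y) \<bullet> ((u + w) /\<^sub>R \<gamma> - v)" if "v \<in> A y" for y v
    proof -
      have inv: "((\<gamma> *\<^sub>R v - w) + w) /\<^sub>R \<gamma> = v" using assms(3) by simp
      have "0 \<le> (x - y) \<bullet> (u - (\<gamma> *\<^sub>R v - w))"
        by (rule rel) (simp only: mem_Collect_eq inv that)
      then show ?thesis
        using assms(3) unfolding eq[of x y u "\<gamma> *\<^sub>R v - w"] inv by (simp add: zero_le_mult_iff)
    qed
    moreover have "(u + w) /\<^sub>R \<gamma> \<in> X"
      by (intro subspace_mul subspace_add assms that)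
    ultimately have "(u + w) /\<^sub>R \<gamma> \<in> A x"
      by (intro maximally_monotone_on_max[OF assms(1)] that(1))
    then show ?thesis by simp
  qed
qed

section \<open>Zeros of the identity plus a maximally monotone operator\<close>

lemma complete_Times:
  fixes S :: "'a::metric_space set" and T :: "'b::metric_space set"
  assumes "complete S" "complete T"
  shows "complete (S \<times> T)"
  unfolding complete_def
proof (intro allI impI, elim conjE)
  fix f :: "nat \<Rightarrow> 'a \<times> 'b"
  assume f: "\<forall>n. f n \<in> S \<times> T" "Cauchy f"
  have "\<forall>n. fst (f n) \<in> S" "\<forall>n. snd (f n) \<in> T"
    using f(1) by (simp_all add: mem_Times_iff)
  then obtain x y where "x \<in> S" "(\<lambda>n. fst (f n)) \<longlonglongrightarrow> x" "y \<in> T" "(\<lambda>n. snd (f n)) \<longlonglongrightarrow> y"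
    using assms Cauchy_fst[OF f(2)] Cauchy_snd[OF f(2)] unfolding complete_def by meson
  then show "\<exists>l\<in>S \<times> T. f \<longlonglongrightarrow> l"
    using tendsto_Pair[of "\<lambda>n. fst (f n)" x sequentially "\<lambda>n. snd (f n)" y] by auto
qed

text \<open>The Fitzpatrick function \<open>F (x, u) = sup {x \<bullet> v + y \<bullet> u - y \<bullet> v | v \<in> A y}\<close> may be infinite,
  so the proof works with its epigraph.\<close>

lemma minty_zero:
  fixes A :: "'a::real_inner \<Rightarrow> 'a set"
  assumes A: "maximally_monotone_on X A" and X: "subspace X" "complete X"
  obtains x where "- x \<in> A x"
proof -
  let ?E = "{(p, r). p \<in> X \<times> X \<and> (\<forall>y. \<forall>v\<in>A y. fst p \<bullet> v + y \<bullet> snd p - y \<bullet> v \<le> r)}"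
  have E: "?E = (X \<times> X) \<times> UNIV \<inter>
      (\<Inter>y. \<Inter>v\<in>A y. {q. fst (fst q) \<bullet> v + y \<bullet> snd (fst q) - y \<bullet> v \<le> snd q})"
    by auto
  have convex_half: "convex {q. fst (fst q) \<bullet> v + y \<bullet> snd (fst q) - y \<bullet> v \<le> snd q}" for v y :: 'a
  proof (rule convexI)
    fix p q :: "('a \<times> 'a) \<times> real" and t t' :: real
    assume *: "p \<in> {q. fst (fst q) \<bullet> v + y \<bullet> snd (fst q) - y \<bullet> v \<le> snd q}"
      "q \<in> {q. fst (fst q) \<bullet> v + y \<bullet> snd (fst q) - y \<bullet> v \<le> snd q}"
      "0 \<le> t" "0 \<le> t'" "t + t' = 1"
    obtain a b r c d s where pq: "p = ((a, b), r)" "q = ((c, d), s)"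
      by (metis prod.collapse)
    have "(t *\<^sub>R a + t' *\<^sub>R c) \<bullet> v + y \<bullet> (t *\<^sub>R b + t' *\<^sub>R d) - (t + t') * (y \<bullet> v)
        = t * (a \<bullet> v + y \<bullet> b - y \<bullet> v) + t' * (c \<bullet> v + y \<bullet> d - y \<bullet> v)"
      by (simp add: inner_simps algebra_simps)
    also have "\<dots> \<le> t * r + t' * s"
      using * pq by (intro add_mono mult_left_mono) auto
    finally show "t *\<^sub>R p + t' *\<^sub>R q \<in> {q. fst (fst q) \<bullet> v + y \<bullet> snd (fst q) - y \<bullet> v \<le> snd q}"
      using * pq by simp
  qed
  have convex: "convex ?E"
    unfolding E by (intro convex_Int convex_Times convex_INT convex_half subspace_imp_convex X convex_UNIV)
  have closed: "closed ?E"
    unfolding E by (intro closed_Int closed_Times closed_INT ballI closed_Collect_le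
        complete_imp_closed X closed_UNIV continuous_intros)
  \<comment> \<open>The Fitzpatrick function dominates the pairing \<open>x \<bullet> u\<close>.
    Otherwise \<open>(x, u)\<close> would be monotonically related to the graph, hence in it, and
    the constraint for \<open>y = x\<close>, \<open>v = u\<close> would give the bound after
    all.\<close>
  have above: "x \<bullet> u \<le> r" if "((x, u), r) \<in> ?E" for x u r
  proof (rule ccontr)
    assume "\<not> x \<bullet> u \<le> r"
    moreover from this have "0 \<le> (x - y) \<bullet> (u - v)" if "v \<in> A y" for y v
      using \<open>((x, u), r) \<in> ?E\<close> that by (fastforce simp: inner_simps)
    then have "u \<in> A x"
      using that by (intro maximally_monotone_on_max[OF A]) auto
    ultimately show False
      using that by (force simp: inner_commute)
  qed
  have bound: "0 \<le> r + (norm p)\<^sup>2 / 2" if "(p, r) \<in> ?E" for p r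
  proof -
    obtain x u where p: "p = (x, u)" by (cases p)
    \<comment> \<open>The pairing plus half the squared norm of \<open>(x, u)\<close> is a perfect
      square, so the regularized function is bounded below by 0.\<close>
    have "0 \<le> (norm (x + u))\<^sup>2 / 2" by simp
    also have "\<dots> = x \<bullet> u + (norm p)\<^sup>2 / 2"
      unfolding power2_norm_eq_inner p by (simp add: inner_simps inner_commute field_simps)
    finally show ?thesis
      using above[of x u r] that p by auto
  qed
  have graph: "((y, v), y \<bullet> v) \<in> ?E" if "v \<in> A y" for y v
    using maximally_monotone_on_operator[OF A that] maximally_monotone_on_mono[OF A that]
    by (fastforce simp: inner_simps inner_commute)
  \<comment> \<open>An empty graph would be vacuously related to \<open>(0, 0)\<close>,
    contradicting maximality.\<close>
  obtain y v where "v \<in> A y"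
    using maximally_monotone_on_max[OF A, of 0 0] X(1) by (auto simp: subspace_0)
  then have "?E \<noteq> {}" using graph by blast
  moreover have "complete (X \<times> X)" by (rule complete_Times[OF X(2) X(2)])
  moreover have "fst ` ?E \<subseteq> X \<times> X" by auto
  ultimately have "\<exists>p r. (p, r) \<in> ?E \<and> (\<forall>q s. (q, s) \<in> ?E \<longrightarrow> r \<le> s + p \<bullet> (q - p))"
    by (rule epigraph_regularized_minimizer[OF convex closed _ _ _ bound])
  then obtain p r where mem: "(p, r) \<in> ?E"
    and opt: "\<forall>q s. (q, s) \<in> ?E \<longrightarrow> r \<le> s + p \<bullet> (q - p)"
    by (elim exE conjE)
  obtain x u where p: "p = (x, u)" by (cases p)
  \<comment> \<open>Optimality is tested at the graph point \<open>(y, v)\<close> with height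
    \<open>y \<bullet> v\<close>, while the minimal height is at least \<open>x \<bullet> u\<close>;
    the rest is rearrangement.\<close>
  have rel: "(norm (x + u))\<^sup>2 \<le> (y + u) \<bullet> (v + x)" if "v \<in> A y" for y v
  proof -
    have "x \<bullet> u \<le> y \<bullet> v + p \<bullet> ((y, v) - p)"
      using above[of x u r] mem opt[rule_format, OF graph[OF that]] p by force
    then show ?thesis
      unfolding power2_norm_eq_inner p by (simp add: inner_simps inner_commute)
  qed
  \<comment> \<open>By \<open>rel\<close>, \<open>(- u, - x)\<close> is monotonically related to the
    graph. Being then in the graph, it may be inserted into \<open>rel\<close> itself, where the
    right-hand side vanishes and forces \<open>x = - u\<close>.\<close>
  have mem': "- x \<in> A (- u)"
  proof (rule maximally_monotone_on_max[OF A])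
    show "- u \<in> X" "- x \<in> X"
      using mem p X(1) by (auto simp: subspace_neg)
    show "0 \<le> (- u - y) \<bullet> (- x - v)" if "v \<in> A y" for y v
      using order_trans[OF zero_le_power2 rel[OF that]] by (simp add: inner_simps)
  qed
  from rel[OF mem'] have "x = - u" by (simp add: eq_neg_iff_add_eq_0)
  with mem' show thesis by (intro that[of "- u"]) simp
qed

section \<open>Metrics and the inclusion \<open>x \<in> M u + A u\<close>\<close>

lemma metric_on_diff:
  assumes "metric_on X M" "subspace X" "x \<in> X" "y \<in> X"
  shows "M (x - y) = M x - M y"
proof -
  have "M (x + (-1) *\<^sub>R y) = M x + M ((-1) *\<^sub>R y)"
    using assms subspace_mul[OF assms(2,4)] unfolding metric_on_def by metis
  also have "M ((-1) *\<^sub>R y) = (-1) *\<^sub>R M y"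
    using assms unfolding metric_on_def by metis
  finally show ?thesis by simp
qed

lemma metric_on_zero: "metric_on X M \<Longrightarrow> subspace X \<Longrightarrow> M 0 = 0"
  using metric_on_diff[of X M 0 0] subspace_0[of X] by simp

text \<open>With \<open>J\<close> the resolvent of \<open>\<gamma> A\<close>, the solutions of \<open>x \<in> M u + A u\<close> are the fixed points of
  \<open>u \<mapsto> J (u - \<gamma> (M u - x))\<close>, a contraction for small \<open>\<gamma>\<close>.\<close>

lemma minty:
  fixes A :: "'a::real_inner \<Rightarrow> 'a set"
  assumes A: "maximally_monotone_on X A" and X: "subspace X" "complete X"
    and M: "metric_on X M" and x: "x \<in> X"
  shows "\<exists>!u. x - M u \<in> A u"
proof (rule ex_ex1I)
  obtain \<mu> where \<mu>: "\<mu> > 0" "\<And>x. x \<in> X \<Longrightarrow> \<mu> * (norm x)\<^sup>2 \<le> M x \<bullet> x"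
    using M by (auto simp: metric_on_def)
  obtain K where K: "\<And>x. x \<in> X \<Longrightarrow> norm (M x) \<le> K * norm x"
    using M unfolding metric_on_def by blast
  have MX: "M x \<in> X" if "x \<in> X" for x
    using M that by (auto simp: metric_on_def)
  note diff = metric_on_diff[OF M X(1)]
  show "u = v" if u: "x - M u \<in> A u" and v: "x - M v \<in> A v" for u v
  proof -
    have uv: "u \<in> X" "v \<in> X"
      using maximally_monotone_on_operator[OF A] u v by auto
    have "0 \<le> (u - v) \<bullet> ((x - M u) - (x - M v))"
      by (rule maximally_monotone_on_mono[OF A u v])
    also have "\<dots> = - (M (u - v) \<bullet> (u - v))"
      by (simp add: diff uv inner_simps inner_commute)
    finally have "\<mu> * (norm (u - v))\<^sup>2 \<le> 0"
      using \<mu>(2)[OF subspace_diff[OF X(1) uv]] by linarith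
    with \<mu>(1) show ?thesis by (simp add: mult_le_0_iff)
  qed
  \<comment> \<open>On the trivial space \<open>K\<close> may be below \<open>\<mu>\<close> or even
    negative. The enlarged bound is positive and keeps \<open>\<mu> / K'\<close> at most 1.\<close>
  define K' where "K' = max \<bar>K\<bar> \<mu>"
  have K': "norm (M x) \<le> K' * norm x" if "x \<in> X" for x
  proof -
    have "K \<le> K'" by (simp add: K'_def)
    then show ?thesis
      using K[OF that] mult_right_mono[of K K' "norm x"] by simp
  qed
  have K'_pos: "K' > 0" "\<mu> \<le> K'" using \<mu>(1) by (auto simp: K'_def)
  \<comment> \<open>This step size minimizes
    \<open>1 - 2 * \<gamma> * \<mu> + \<gamma>\<^sup>2 * K'\<^sup>2\<close>; the minimum is the
    square of the contraction factor \<open>c\<close> below.\<close>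
  define \<gamma> where "\<gamma> = \<mu> / K'\<^sup>2"
  have \<gamma>: "\<gamma> > 0" using \<mu>(1) K'_pos by (simp add: \<gamma>_def)
  have "\<exists>u. (w - u) /\<^sub>R \<gamma> \<in> A u" if "w \<in> X" for w
    using minty_zero[OF maximally_monotone_on_affine[OF A X(1) \<gamma> that] X]
    by (metis (no_types, lifting) mem_Collect_eq uminus_add_conv_diff)
  then obtain J where J: "\<And>w. w \<in> X \<Longrightarrow> (w - J w) /\<^sub>R \<gamma> \<in> A (J w)" by metis
  have JX: "J w \<in> X" if "w \<in> X" for w
    using maximally_monotone_on_operator[OF A J[OF that]] by blast
  have J_nonexpansive: "norm (J w - J w') \<le> norm (w - w')" if "w \<in> X" "w' \<in> X" for w w'
  proof -
    have "0 \<le> (J w - J w') \<bullet> ((w - J w) /\<^sub>R \<gamma> - (w' - J w') /\<^sub>R \<gamma>)"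
      by (rule maximally_monotone_on_mono[OF A J[OF that(1)] J[OF that(2)]])
    also have "(w - J w) /\<^sub>R \<gamma> - (w' - J w') /\<^sub>R \<gamma> = ((w - w') - (J w - J w')) /\<^sub>R \<gamma>"
      by (simp flip: scaleR_diff_right)
    also have "(J w - J w') \<bullet> \<dots> = ((J w - J w') \<bullet> (w - w') - (norm (J w - J w'))\<^sup>2) / \<gamma>"
      by (simp add: inner_diff_right power2_norm_eq_inner divide_inverse mult.commute)
    finally have "(norm (J w - J w'))\<^sup>2 \<le> (J w - J w') \<bullet> (w - w')"
      using \<gamma> by (simp add: zero_le_divide_iff)
    also have "\<dots> \<le> norm (J w - J w') * norm (w - w')"
      by (rule norm_cauchy_schwarz)
    finally show ?thesis
      by (cases "norm (J w - J w') = 0") (auto simp: power2_eq_square)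
  qed
  define c where "c = sqrt (1 - (\<mu> / K')\<^sup>2)"
  have ratio: "0 < (\<mu> / K')\<^sup>2" "(\<mu> / K')\<^sup>2 \<le> 1"
    using \<mu>(1) K'_pos by (auto simp: power_le_one)
  then have c: "0 \<le> c" "c < 1" by (auto simp: c_def)
  have step: "norm (u - \<gamma> *\<^sub>R M u) \<le> c * norm u" if u: "u \<in> X" for u
  proof (rule power2_le_imp_le)
    have "(norm (u - \<gamma> *\<^sub>R M u))\<^sup>2 = (norm u)\<^sup>2 - 2 * \<gamma> * (M u \<bullet> u) + \<gamma>\<^sup>2 * (norm (M u))\<^sup>2"
      unfolding power2_norm_eq_inner
      by (simp add: inner_simps inner_commute power2_eq_square algebra_simps)
    also have "\<dots> \<le> (norm u)\<^sup>2 - 2 * \<gamma> * (\<mu> * (norm u)\<^sup>2) + \<gamma>\<^sup>2 * (K' * norm u)\<^sup>2"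
      using \<mu>(2)[OF u] K'[OF u] \<gamma> by (intro add_mono diff_mono mult_left_mono power_mono) auto
    also have "\<dots> = (1 - (\<mu> / K')\<^sup>2) * (norm u)\<^sup>2"
      using K'_pos by (simp add: \<gamma>_def field_simps power2_eq_square)
    also have "\<dots> = (c * norm u)\<^sup>2"
      using ratio by (simp add: c_def power_mult_distrib)
    finally show "(norm (u - \<gamma> *\<^sub>R M u))\<^sup>2 \<le> (c * norm u)\<^sup>2" .
  qed (use c in auto)
  define f where "f = (\<lambda>u. J (u - \<gamma> *\<^sub>R M u + \<gamma> *\<^sub>R x))"
  have arg: "u - \<gamma> *\<^sub>R M u + \<gamma> *\<^sub>R x \<in> X" if "u \<in> X" for u
    using that x MX X(1) by (intro subspace_add subspace_diff subspace_mul)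
  have "\<exists>!u\<in>X. f u = u"
  proof (rule Banach_fix[OF X(2) _ c])
    show "X \<noteq> {}" using x by blast
    show "f ` X \<subseteq> X" using arg JX by (auto simp: f_def)
    fix u v assume uv: "u \<in> X" "v \<in> X"
    have "dist (f u) (f v) \<le> norm ((u - v) - \<gamma> *\<^sub>R M (u - v))"
      using J_nonexpansive[OF arg[OF uv(1)] arg[OF uv(2)]]
      by (simp add: f_def dist_norm diff uv algebra_simps)
    also have "\<dots> \<le> c * norm (u - v)"
      by (rule step) (simp add: uv X subspace_diff)
    finally show "dist (f u) (f v) \<le> c * dist u v" by (simp add: dist_norm)
  qed
  then obtain u where u: "u \<in> X" "f u = u" by blast
  have "((u - \<gamma> *\<^sub>R M u + \<gamma> *\<^sub>R x) - u) /\<^sub>R \<gamma> \<in> A u"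
    using J[OF arg[OF u(1)]] u(2) by (simp add: f_def)
  also have "((u - \<gamma> *\<^sub>R M u + \<gamma> *\<^sub>R x) - u) /\<^sub>R \<gamma> = x - M u"
    using \<gamma> by (simp add: scaleR_diff_right)
  finally show "\<exists>u. x - M u \<in> A u" by blast
qed

text \<open>Minty's theorem for the zero operator says that \<open>M u = x\<close> has exactly one
  solution.\<close>

lemma metric_on_bij:
  assumes M: "metric_on UNIV (M :: 'a::{real_inner,complete_space} \<Rightarrow> 'a)"
  shows "bij M"
proof -
  have "maximally_monotone_on UNIV (\<lambda>_. {0 :: 'a})"
  proof (rule maximally_monotone_onI)
    show "u \<in> {0}" if rel: "\<And>y v. v \<in> {0} \<Longrightarrow> 0 \<le> (x - y) \<bullet> (u - v)" for x u :: 'a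
    proof -
      have "u \<bullet> u \<le> 0" using rel[of 0 "x + u"] by simp
      then show ?thesis using inner_gt_zero_iff[of u] by (simp add: not_less[symmetric])
    qed
  qed (auto simp: operator_on_def monotone_operator_def)
  from minty[OF this subspace_UNIV complete_UNIV M] have "\<exists>!u. x - M u \<in> {0}" for x
    by blast
  moreover have "x - M u \<in> {0} \<longleftrightarrow> M u = x" for x u by auto
  ultimately show ?thesis by (simp add: bij_iff)
qed

lemma metric_on_add:
  assumes "metric_on UNIV M" "metric_on UNIV N"
  shows "metric_on UNIV (\<lambda>x. M x + N x)"
proof -
  obtain \<mu> \<nu> where "\<mu> > 0" "\<And>x. \<mu> * (norm x)\<^sup>2 \<le> M x \<bullet> x" "\<nu> > 0" "\<And>x. \<nu> * (norm x)\<^sup>2 \<le> N x \<bullet> x"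
    using assms by (auto simp: metric_on_def)
  then have "\<exists>\<kappa>>0. \<forall>x. \<kappa> * (norm x)\<^sup>2 \<le> (M x + N x) \<bullet> x"
    by (intro exI[of _ "\<mu> + \<nu>"]) (simp add: inner_add_left distrib_right add_mono)
  then show ?thesis
    using assms by (simp add: metric_on_UNIV bounded_linear_add inner_simps)
qed

lemma metric_on_sum:
  assumes "finite I" "I \<noteq> {}" "\<And>i. i \<in> I \<Longrightarrow> metric_on UNIV (M i)"
  shows "metric_on UNIV (\<lambda>x. \<Sum>i\<in>I. M i x)"
  using assms by (induction I rule: finite_ne_induct) (auto intro: metric_on_add)

text \<open>Subtracting \<open>\<nu>\<close> times the identity from \<open>D\<close> leaves a
  maximally monotone operator, so \<open>s \<in> D x\<close> becomes the inclusion of Minty's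
  theorem with the metric \<open>\<nu>\<close> times the identity.\<close>

lemma strongly_monotone_ex1:
  fixes D :: "'a::real_inner \<Rightarrow> 'a set"
  assumes D: "maximally_monotone_on X D" "strongly_monotone \<nu> D" and \<nu>: "\<nu> > 0"
    and X: "subspace X" "complete X" and s: "s \<in> X"
  shows "\<exists>!x. s \<in> D x"
proof (rule ex_ex1I)
  let ?D = "\<lambda>x. {v. v + \<nu> *\<^sub>R x \<in> D x}"
  have shift: "u + \<nu> *\<^sub>R x - (v + \<nu> *\<^sub>R y) = (u - v) + \<nu> *\<^sub>R (x - y)" for u x v y :: 'a
    by (simp add: algebra_simps)
  have "maximally_monotone_on X ?D"
  proof (rule maximally_monotone_onI)
    have "x \<in> X \<and> v \<in> X" if "v + \<nu> *\<^sub>R x \<in> D x" for x v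
      using maximally_monotone_on_operator[OF D(1) that] X(1)
      by (metis add_diff_cancel_right' subspace_diff subspace_mul)
    then show "operator_on X ?D" by (auto simp: operator_on_def)
    have "0 \<le> (x - y) \<bullet> (u - v)" if "u + \<nu> *\<^sub>R x \<in> D x" "v + \<nu> *\<^sub>R y \<in> D y" for x y u v
    proof -
      have "\<nu> * (norm (x - y))\<^sup>2 \<le> (x - y) \<bullet> (u + \<nu> *\<^sub>R x - (v + \<nu> *\<^sub>R y))"
        using D(2) that unfolding strongly_monotone_def by blast
      then show ?thesis
        unfolding shift by (simp add: inner_add_right power2_norm_eq_inner)
    qed
    then show "monotone_operator ?D" by (auto simp: monotone_operator_def)
    show "u \<in> ?D x" if "x \<in> X" "u \<in> X"
      and rel: "\<And>y v. v \<in> ?D y \<Longrightarrow> 0 \<le> (x - y) \<bullet> (u - v)" for x u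
    proof -
      \<comment> \<open>A pair related to the reduced operator is related to \<open>D\<close> after
        shifting back, because the shift adds the nonnegative term
        \<open>\<nu> * ((x - y) \<bullet> (x - y))\<close>.\<close>
      have "0 \<le> (x - y) \<bullet> (u + \<nu> *\<^sub>R x - v)" if "v \<in> D y" for y v
      proof -
        have "0 \<le> (x - y) \<bullet> (u - (v - \<nu> *\<^sub>R y))" using that by (intro rel) simp
        moreover have "(x - y) \<bullet> (u + \<nu> *\<^sub>R x - v)
            = (x - y) \<bullet> (u - (v - \<nu> *\<^sub>R y)) + \<nu> * ((x - y) \<bullet> (x - y))"
          by (simp add: inner_simps algebra_simps)
        ultimately show ?thesis using \<nu> by simp
      qed
      then have "u + \<nu> *\<^sub>R x \<in> D x"
        using that(1,2) X(1) by (intro maximally_monotone_on_max[OF D(1)] subspace_add subspace_mul) auto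
      then show ?thesis by simp
    qed
  qed
  moreover have "metric_on X (\<lambda>x. \<nu> *\<^sub>R x)"
    using \<nu> X(1) unfolding metric_on_def
    by (auto simp: subspace_mul scaleR_add_right power2_norm_eq_inner intro!: exI[of _ \<nu>])
  ultimately have "\<exists>!u. s - \<nu> *\<^sub>R u \<in> ?D u"
    using minty X s by blast
  then show "\<exists>x. s \<in> D x" by auto
  show "x = y" if "s \<in> D x" "s \<in> D y" for x y
  proof -
    have "\<nu> * (norm (x - y))\<^sup>2 \<le> (x - y) \<bullet> (s - s)"
      using D(2) that unfolding strongly_monotone_def by blast
    then show ?thesis using \<nu> by (simp add: mult_le_0_iff)
  qed
qed

section \<open>Inclusions with exactly one solution\<close>

lemma zero_in_plus_singleton:
  fixes e :: "'a::ab_group_add"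
  shows "0 \<in> A + {e} \<longleftrightarrow> - e \<in> A"
proof -
  have "0 = a + e \<longleftrightarrow> a = - e" for a
    by (metis eq_neg_iff_add_eq_0)
  then show ?thesis by (simp add: set_plus_def)
qed

lemma plus_singletons:
  fixes a b :: "'a::ab_group_add"
  shows "A + {a} + {b} = A + {a + b}"
  by (simp add: add.assoc) (simp add: set_plus_def)

lemma ex1_unique: "\<exists>!x. P x \<Longrightarrow> P a \<Longrightarrow> P b \<Longrightarrow> a = b"
  by blast

text \<open>This is the common shape of the root, node and dual steps. The form of \<open>E\<close>
  is prescribed on \<open>X\<close> alone, since \<open>A u\<close> is empty elsewhere.\<close>

lemma inclusion_ex1:
  fixes A :: "'a::real_inner \<Rightarrow> 'a set"
  assumes A: "maximally_monotone_on X A" and X: "subspace X" "complete X"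
    and M: "metric_on X M" and w: "w \<in> X"
    and E: "\<And>u. u \<in> X \<Longrightarrow> E u = M u - w"
  shows "\<exists>!u. 0 \<in> A u + {E u}"
proof -
  have "0 \<in> A u + {E u} \<longleftrightarrow> w - M u \<in> A u" for u
    using E[of u] maximally_monotone_on_operator[OF A, of _ u]
    by (auto simp: zero_in_plus_singleton)
  then show ?thesis using minty[OF A X M w] by simp
qed

section \<open>Rooted trees\<close>

lemma cells_partition_sum:
  assumes "cells_partition I F S" "finite I" "finite S"
  shows "sum f S = (\<Sum>i\<in>I. sum f (F i))"
proof -
  have S: "S = (\<Union>i\<in>I. F i)" and "disjoint_family_on F I"
    using assms(1) by (auto simp: cells_partition_def)
  moreover have "\<forall>i\<in>I. finite (F i)"
    using S assms(3) by (auto intro: finite_subset)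
  ultimately show ?thesis
    using sum.UNION_disjoint[OF assms(2), of F f] by (auto simp: disjoint_family_on_def)
qed

text \<open>Labels need not increase away from the root, so the induction runs along the chain of
  parents from \<open>i\<close> to 0.\<close>

lemma rooted_tree_induct [consumes 2, case_names root node]:
  assumes "rooted_tree n par" "i < n"
    and "P 0" "\<And>i. i \<in> {1..<n} \<Longrightarrow> P (par i) \<Longrightarrow> P i"
  shows "P i"
proof -
  have "(i, 0) \<in> {(c, par c) | c. c \<in> {1..<n}}\<^sup>*"
    using assms(1,2) by (auto simp: rooted_tree_def)
  then show ?thesis
    by (induction rule: converse_rtrancl_induct) (use assms(3,4) in auto)
qed

section \<open>Recursion along the tree in both directions\<close>

lemma wf_rooted_tree_parent:
  assumes "rooted_tree n par"
  shows "wf {(par c, c) | c. c \<in> {1..<n}}"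
proof (rule wfUNIVI)
  fix P :: "nat \<Rightarrow> bool" and i
  assume step: "\<forall>i. (\<forall>j. (j, i) \<in> {(par c, c) | c. c \<in> {1..<n}} \<longrightarrow> P j) \<longrightarrow> P i"
  show "P i"
  proof (cases "i < n")
    case True
    with assms show ?thesis
    proof (induction rule: rooted_tree_induct)
      case root
      show ?case by (rule step[rule_format]) simp
    next
      case (node i)
      show ?case by (rule step[rule_format]) (use node in auto)
    qed
  next
    case False
    show ?thesis by (rule step[rule_format]) (use False in auto)
  qed
qed

text \<open>A well-founded relation is acyclic, and a finite acyclic relation has a well-founded
  converse.\<close>

lemma wf_rooted_tree_child:
  assumes "rooted_tree n par"
  shows "wf {(c, par c) | c. c \<in> {1..<n}}"
proof -
  have "finite ((\<lambda>c. (par c, c)) ` {1..<n})" by simp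
  moreover have "{(par c, c) | c. c \<in> {1..<n}} = (\<lambda>c. (par c, c)) ` {1..<n}" by auto
  ultimately have "wf ({(par c, c) | c. c \<in> {1..<n}}\<inverse>)"
    using wf_rooted_tree_parent[OF assms] by (intro finite_acyclic_wf_converse wf_acyclic) auto
  moreover have "{(par c, c) | c. c \<in> {1..<n}}\<inverse> = {(c, par c) | c. c \<in> {1..<n}}" by auto
  ultimately show ?thesis by simp
qed

text \<open>This recursion produces the node values of a prediction.\<close>

lemma rooted_tree_top_down:
  assumes "rooted_tree n par"
  obtains f where "f 0 = a" "\<And>i. i \<in> {1..<n} \<Longrightarrow> f i = F i (f (par i))"
proof -
  let ?R = "{(par c, c) | c. c \<in> {1..<n}}"
  define f where "f = wfrec ?R (\<lambda>g i. if i = 0 then a else F i (g (par i)))"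
  have f: "f i = (if i = 0 then a else F i (cut f ?R i (par i)))" for i
    unfolding f_def by (subst wfrec[OF wf_rooted_tree_parent[OF assms]]) simp
  show thesis
  proof (rule that)
    show "f i = F i (f (par i))" if "i \<in> {1..<n}" for i
      using that f[of i] by (auto simp: cut_apply)
  qed (simp add: f)
qed

text \<open>The step function may inspect the values at all children at once; the default
  \<open>undefined\<close> elsewhere is the one of \<open>cut\<close>. It serves to prescribe the
  edge terms from a solution of (P).\<close>

lemma rooted_tree_bottom_up:
  assumes "rooted_tree n par"
  shows "\<exists>f. \<forall>i. f i = F i (\<lambda>c. if c \<in> {1..<n} \<and> par c = i then f c else undefined)"
proof -
  let ?R = "{(c, par c) | c. c \<in> {1..<n}}"
  define f where "f = wfrec ?R (\<lambda>g i. F i g)"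
  have "f i = F i (cut f ?R i)" for i
    unfolding f_def by (subst wfrec[OF wf_rooted_tree_child[OF assms]]) simp
  moreover have "cut f ?R i = (\<lambda>c. if c \<in> {1..<n} \<and> par c = i then f c else undefined)" for i
    by (auto simp: cut_def fun_eq_iff)
  ultimately show ?thesis by (intro exI[of _ f]) simp
qed

section \<open>Predictions and their fixed points\<close>

lemma
  assumes "is_prediction Q G M N z s u zt st"
  shows is_prediction_mem: "u \<in> {..<numA Q} \<rightarrow>\<^sub>E UNIV" "zt \<in> H_fam Q" "st \<in> K_fam Q"
    and is_prediction_root: "0 \<in> opA Q 0 (u 0)
         + {(\<Sum>c\<in>ch Q G 0. M c (u 0 - z c))
            + (\<Sum>j\<in>cellJ G 0. adjoint (opL Q j) (s j)) - vecA Q}"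
    and is_prediction_dual: "i < numA Q \<Longrightarrow> j \<in> cellJ G i \<Longrightarrow>
        0 \<in> inverse_op (opB Q j) (st j) + {N j (st j - s j)} + inverse_op (opD Q j) (s j)
            + {- opL Q j (u i) + vecB Q j}"
    and is_prediction_node: "i \<in> {1..<numA Q} \<Longrightarrow>
        0 \<in> opA Q i (u i)
            + {M i (u i + z i - 2 *\<^sub>R u (pa G i))
               + (\<Sum>c\<in>ch Q G i. M c (u i - z c))
               + (\<Sum>l\<in>cellP G i. opC Q l (u (pa G i)))
               + (\<Sum>j\<in>cellJ G i. adjoint (opL Q j) (s j))
               + (\<Sum>j\<in>cellJc G i. adjoint (opL Q j) (st j - s j))}"
    and is_prediction_zt: "i \<in> {1..<numA Q} \<Longrightarrow> zt i = z i + u i - u (pa G i)"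
  using assms unfolding is_prediction_def by blast+

section \<open>Consequences of the standing assumptions\<close>

locale splitting =
  fixes Q :: "('h::{real_inner,complete_space}, 'k::real_inner) problem"
    and G :: tree_data
    and M :: "nat \<Rightarrow> 'h \<Rightarrow> 'h" and N :: "nat \<Rightarrow> 'k \<Rightarrow> 'k"
  assumes problem: "valid_problem Q"
    and tree: "valid_tree Q G"
    and metrics: "valid_metrics Q M N"
begin

lemma rooted: "rooted_tree (numA Q) (pa G)"
  using tree by (simp add: valid_tree_def)

lemma parent_less: "i \<in> {1..<numA Q} \<Longrightarrow> pa G i < numA Q"
  using rooted by (simp add: rooted_tree_def)

lemma nodes: "numA Q \<ge> 2"
  using problem by (simp add: valid_problem_def)

lemma nodes_split: "{..<numA Q} = insert 0 {1..<numA Q}"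
  using nodes by auto

lemma ch_subset: "ch Q G i \<subseteq> {1..<numA Q}" and finite_ch [simp]: "finite (ch Q G i)"
  by (auto simp: ch_def)

lemma ch_parent: "i \<in> {1..<numA Q} \<Longrightarrow> i \<in> ch Q G (pa G i)"
  by (simp add: ch_def)

text \<open>Without a child of the root, tree induction would make 0 the only node. The lemma makes
  the metric of the root step uniformly positive definite, as an empty sum would not be.\<close>

lemma ch_root: "ch Q G 0 \<noteq> {}"
proof
  assume *: "ch Q G 0 = {}"
  have "i = 0" if "i < numA Q" for i
    using rooted that by (induction rule: rooted_tree_induct) (use * ch_parent in force)+
  from this[of 1] nodes show False by simp
qed

text \<open>Each node other than the root is a child of exactly one node. This is what makes the
  edge terms cancel in the total.\<close>

lemma sum_ch: "(\<Sum>i<numA Q. \<Sum>c\<in>ch Q G i. f c) = sum f {1..<numA Q}"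
proof -
  have "(\<Sum>i<numA Q. sum f {c. c \<in> {1..<numA Q} \<and> pa G c = i}) = sum f {1..<numA Q}"
    using parent_less by (intro sum.group) auto
  then show ?thesis by (simp add: ch_def)
qed

lemma cellJ: "cells_partition {..<numA Q} (cellJ G) {1..numB Q}"
  and cellP: "cells_partition {..<numA Q} (cellP G) {1..numC Q}"
  and cellP_root: "cellP G 0 = {}"
  using tree by (auto simp: valid_tree_def)

lemma cellJ_subset: "i < numA Q \<Longrightarrow> cellJ G i \<subseteq> {1..numB Q}"
  using cellJ by (auto simp: cells_partition_def)

text \<open>The dual steps are stated per node, whereas the dual variables are indexed by
  \<open>j\<close> alone; \<open>node\<close> recovers the owner of \<open>j\<close>.\<close>

lemma cellJ_node:
  "\<exists>node. (\<forall>j\<in>{1..numB Q}. node j < numA Q \<and> j \<in> cellJ G (node j)) \<and>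
     (\<forall>i<numA Q. \<forall>j\<in>cellJ G i. node j = i)"
proof -
  have ex: "\<exists>i<numA Q. j \<in> cellJ G i" if "j \<in> {1..numB Q}" for j
    using cellJ that unfolding cells_partition_def by blast
  then obtain node where node: "\<And>j. j \<in> {1..numB Q} \<Longrightarrow> node j < numA Q \<and> j \<in> cellJ G (node j)"
    by metis
  moreover have "node j = i" if "i < numA Q" "j \<in> cellJ G i" for i j
  proof (rule ccontr)
    assume "node j \<noteq> i"
    moreover have "node j < numA Q" "j \<in> cellJ G (node j)"
      using node cellJ_subset[OF that(1)] that(2) by auto
    ultimately show False
      using cellJ that by (auto simp: cells_partition_def disjoint_family_on_def)
  qed
  ultimately show ?thesis by (intro exI[of _ node]) simp
qed

text \<open>Hence the dual corrections at node \<open>i\<close> involve only variables already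
  computed at its parent.\<close>

lemma cellJc_subset: "i \<in> {1..<numA Q} \<Longrightarrow> cellJc G i \<subseteq> cellJ G (pa G i)"
proof -
  assume i: "i \<in> {1..<numA Q}"
  then have "ch Q G (pa G i) \<noteq> {}" using ch_parent by blast
  then have "cells_partition (ch Q G (pa G i)) (cellJc G) (cellJ G (pa G i))"
    using tree parent_less[OF i] by (simp add: valid_tree_def)
  then show ?thesis
    using ch_parent[OF i] by (auto simp: cells_partition_def)
qed

lemma opA: "i < numA Q \<Longrightarrow> maximally_monotone_on UNIV (opA Q i)"
  using problem by (simp add: valid_problem_def)

lemma metric_M: "i \<in> {1..<numA Q} \<Longrightarrow> metric_on UNIV (M i)"
  using metrics by (simp add: valid_metrics_def)

lemma linear_M: "i \<in> {1..<numA Q} \<Longrightarrow> linear (M i)"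
  using metric_M by (simp add: metric_on_UNIV bounded_linear.linear)

lemma
  assumes "j \<in> {1..numB Q}"
  shows spK: "subspace (spK Q j)" "complete (spK Q j)"
    and opB: "maximally_monotone_on (spK Q j) (opB Q j)"
    and opL: "bounded_linear (opL Q j)"
    and opL_mem: "opL Q j x \<in> spK Q j"
    and vecB_mem: "vecB Q j \<in> spK Q j"
    and metric_N: "metric_on (spK Q j) (N j)"
    and opD: "s \<in> spK Q j \<Longrightarrow> \<exists>!d. s \<in> opD Q j d"
    and opD_mem: "s \<in> opD Q j d \<Longrightarrow> d \<in> spK Q j"
proof -
  note p = problem[unfolded valid_problem_def]
  show "subspace (spK Q j)" "complete (spK Q j)" "maximally_monotone_on (spK Q j) (opB Q j)"
    "bounded_linear (opL Q j)" "opL Q j x \<in> spK Q j" "vecB Q j \<in> spK Q j"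
    using p assms by blast+
  show "metric_on (spK Q j) (N j)"
    using metrics assms by (simp add: valid_metrics_def)
  have "maximally_monotone_on (spK Q j) (opD Q j)" "strongly_monotone (modD Q j) (opD Q j)"
    "modD Q j > 0" "subspace (spK Q j)" "complete (spK Q j)"
    using p assms by auto
  then show "s \<in> spK Q j \<Longrightarrow> \<exists>!d. s \<in> opD Q j d" "s \<in> opD Q j d \<Longrightarrow> d \<in> spK Q j"
    using strongly_monotone_ex1 maximally_monotone_on_operator by blast+
qed

lemma adjoint_zero: "j \<in> {1..numB Q} \<Longrightarrow> adjoint (opL Q j) 0 = 0"
  by (rule adjoint_zero_hilbert[OF opL])

section \<open>Unique solvability of the single steps\<close>

lemma sum_M_diff: "(\<Sum>c\<in>ch Q G i. M c (u - z c)) = (\<Sum>c\<in>ch Q G i. M c u) - (\<Sum>c\<in>ch Q G i. M c (z c))"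
proof -
  have "(\<Sum>c\<in>ch Q G i. M c (u - z c)) = (\<Sum>c\<in>ch Q G i. M c u - M c (z c))"
    using ch_subset linear_M by (intro sum.cong refl linear_diff) blast
  then show ?thesis by (simp add: sum_subtractf)
qed

lemma metric_root: "metric_on UNIV (\<lambda>u. \<Sum>c\<in>ch Q G 0. M c u)"
  by (intro metric_on_sum finite_ch ch_root metric_M[OF subsetD[OF ch_subset]])

lemma root_ex1: "\<exists>!u. 0 \<in> opA Q 0 u + {(\<Sum>c\<in>ch Q G 0. M c (u - z c)) + k - a}"
proof (rule inclusion_ex1[OF opA subspace_UNIV complete_UNIV metric_root])
  show "(\<Sum>c\<in>ch Q G 0. M c (u - z c)) + k - a
      = (\<Sum>c\<in>ch Q G 0. M c u) - ((\<Sum>c\<in>ch Q G 0. M c (z c)) - k + a)" for u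
    by (simp add: sum_M_diff)
qed (use nodes in auto)

lemma node_ex1:
  assumes i: "i \<in> {1..<numA Q}"
  shows "\<exists>!u. 0 \<in> opA Q i u + {M i (u + z i - 2 *\<^sub>R v) + (\<Sum>c\<in>ch Q G i. M c (u - z c)) + k\<^sub>1 + k\<^sub>2 + k\<^sub>3}"
proof -
  have metric: "metric_on UNIV (\<lambda>u. M i u + (\<Sum>c\<in>ch Q G i. M c u))"
  \<comment> \<open>At a leaf the sum over the children is zero, and \<open>M i\<close> alone is the
    metric.\<close>
  proof (cases "ch Q G i = {}")
    case False
    then show ?thesis
      by (intro metric_on_add metric_on_sum finite_ch metric_M[OF i] metric_M[OF subsetD[OF ch_subset]])
  qed (simp add: metric_M[OF i])
  show ?thesis
  proof (rule inclusion_ex1[OF opA subspace_UNIV complete_UNIV metric])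
    show "M i (u + z i - 2 *\<^sub>R v) + (\<Sum>c\<in>ch Q G i. M c (u - z c)) + k\<^sub>1 + k\<^sub>2 + k\<^sub>3
      = M i u + (\<Sum>c\<in>ch Q G i. M c u)
        - (M i (2 *\<^sub>R v - z i) + (\<Sum>c\<in>ch Q G i. M c (z c)) - k\<^sub>1 - k\<^sub>2 - k\<^sub>3)" for u
      by (simp add: sum_M_diff linear_add[OF linear_M[OF i]] linear_diff[OF linear_M[OF i]])
  qed (use i in auto)
qed

lemma dual_ex1:
  assumes j: "j \<in> {1..numB Q}" and s: "s \<in> spK Q j"
  shows "\<exists>!t. 0 \<in> inverse_op (opB Q j) t + {N j (t - s)} + inverse_op (opD Q j) s
            + {- opL Q j x + vecB Q j}"
proof -
  \<comment> \<open>Strong monotonicity makes the inverse of \<open>opD Q j\<close> single-valued at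
    \<open>s\<close>, so this term joins the constants and a resolvent step for the inverse of
    \<open>opB Q j\<close> remains.\<close>
  obtain d where d: "inverse_op (opD Q j) s = {d}" "s \<in> opD Q j d"
    using opD[OF j s] unfolding inverse_op_def by blast
  have eq: "inverse_op (opB Q j) t + {N j (t - s)} + {d} + {- opL Q j x + vecB Q j}
      = inverse_op (opB Q j) t + {N j (t - s) + d + (- opL Q j x + vecB Q j)}" for t
    by (simp only: plus_singletons)
  note mem = s opD_mem[OF j d(2)] opL_mem[OF j, of x] vecB_mem[OF j]
  have "N j s \<in> spK Q j"
    using metric_N[OF j] s by (auto simp: metric_on_def)
  with mem have w: "N j s - d + opL Q j x - vecB Q j \<in> spK Q j"
    by (intro subspace_add subspace_diff spK(1)[OF j])
  show ?thesis unfolding d(1) eq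
  proof (rule inclusion_ex1[OF maximally_monotone_on_inverse_op[OF opB[OF j]] spK[OF j] metric_N[OF j] w])
    show "N j (t - s) + d + (- opL Q j x + vecB Q j) = N j t - (N j s - d + opL Q j x - vecB Q j)"
      if "t \<in> spK Q j" for t
      using metric_on_diff[OF metric_N[OF j] spK(1)[OF j] that s] by simp
  qed
qed

section \<open>Existence and uniqueness of predictions\<close>

lemma is_prediction_ex:
  assumes zs: "(z, s) \<in> space_zs Q"
  shows "\<exists>u zt st. is_prediction Q G M N z s u zt st"
proof -
  have s: "s j \<in> spK Q j" if "j \<in> {1..numB Q}" for j
    using zs that by (auto simp: space_zs_def)
  obtain a where a: "0 \<in> opA Q 0 a + {(\<Sum>c\<in>ch Q G 0. M c (a - z c))
      + (\<Sum>j\<in>cellJ G 0. adjoint (opL Q j) (s j)) - vecA Q}"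
    using root_ex1 by blast
  \<comment> \<open>\<open>S j x\<close> is the dual output when the owning node has value
    \<open>x\<close>. Below, \<open>F i x\<close> is the value of node \<open>i\<close> when its
    parent has value \<open>x\<close>, so its corrections use the same \<open>x\<close>.\<close>
  obtain S where S: "0 \<in> inverse_op (opB Q j) (S j x) + {N j (S j x - s j)} + inverse_op (opD Q j) (s j)
            + {- opL Q j x + vecB Q j}" if "j \<in> {1..numB Q}" for j x
    using dual_ex1[OF _ s] by metis
  have S_mem: "S j x \<in> spK Q j" if "j \<in> {1..numB Q}" for j x
    using S[OF that, of x] maximally_monotone_on_operator[OF opB[OF that]]
    by (auto simp: set_plus_def inverse_op_def)
  define F where "F = (\<lambda>i x. THE y. 0 \<in> opA Q i y
            + {M i (y + z i - 2 *\<^sub>R x)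
               + (\<Sum>c\<in>ch Q G i. M c (y - z c))
               + (\<Sum>l\<in>cellP G i. opC Q l x)
               + (\<Sum>j\<in>cellJ G i. adjoint (opL Q j) (s j))
               + (\<Sum>j\<in>cellJc G i. adjoint (opL Q j) (S j x - s j))})"
  have F: "0 \<in> opA Q i (F i x)
            + {M i (F i x + z i - 2 *\<^sub>R x)
               + (\<Sum>c\<in>ch Q G i. M c (F i x - z c))
               + (\<Sum>l\<in>cellP G i. opC Q l x)
               + (\<Sum>j\<in>cellJ G i. adjoint (opL Q j) (s j))
               + (\<Sum>j\<in>cellJc G i. adjoint (opL Q j) (S j x - s j))}"
    if "i \<in> {1..<numA Q}" for i x
    unfolding F_def by (rule theI'[OF node_ex1[OF that]])
  obtain f where f: "f 0 = a" "\<And>i. i \<in> {1..<numA Q} \<Longrightarrow> f i = F i (f (pa G i))"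
    using rooted_tree_top_down[OF rooted, of a F] by blast
  obtain node where node: "\<forall>i<numA Q. \<forall>j\<in>cellJ G i. node j = i"
    using cellJ_node by blast
  define u where "u = restrict f {..<numA Q}"
  define st where "st = (\<lambda>j\<in>{1..numB Q}. S j (f (node j)))"
  define zt where "zt = (\<lambda>i\<in>{1..<numA Q}. z i + u i - u (pa G i))"
  have u: "u i = f i" if "i < numA Q" for i
    using that by (simp add: u_def)
  have st: "st j = S j (f i)" if "i < numA Q" "j \<in> cellJ G i" for i j
    using that cellJ_subset[OF that(1)] node that by (auto simp: st_def)
  have "is_prediction Q G M N z s u zt st"
    unfolding is_prediction_def
  proof (intro conjI ballI allI impI)
    show "u \<in> {..<numA Q} \<rightarrow>\<^sub>E UNIV" "zt \<in> H_fam Q" "st \<in> K_fam Q"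
      using S_mem by (auto simp: u_def zt_def st_def)
    show "0 \<in> opA Q 0 (u 0)
         + {(\<Sum>c\<in>ch Q G 0. M c (u 0 - z c))
            + (\<Sum>j\<in>cellJ G 0. adjoint (opL Q j) (s j)) - vecA Q}"
      using a nodes by (simp add: u f)
    show "0 \<in> inverse_op (opB Q j) (st j) + {N j (st j - s j)} + inverse_op (opD Q j) (s j)
            + {- opL Q j (u i) + vecB Q j}" if "i < numA Q" "j \<in> cellJ G i" for i j
      using S[of j "f i"] cellJ_subset[OF that(1)] that by (auto simp: st u)
    show "zt i = z i + u i - u (pa G i)" if "i \<in> {1..<numA Q}" for i
      using that by (simp add: zt_def)
    fix i assume i: "i \<in> {1..<numA Q}"
    have "(\<Sum>j\<in>cellJc G i. adjoint (opL Q j) (st j - s j))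
        = (\<Sum>j\<in>cellJc G i. adjoint (opL Q j) (S j (f (pa G i)) - s j))"
      using st[OF parent_less[OF i]] cellJc_subset[OF i] by (intro sum.cong) auto
    then show "0 \<in> opA Q i (u i)
            + {M i (u i + z i - 2 *\<^sub>R u (pa G i))
               + (\<Sum>c\<in>ch Q G i. M c (u i - z c))
               + (\<Sum>l\<in>cellP G i. opC Q l (u (pa G i)))
               + (\<Sum>j\<in>cellJ G i. adjoint (opL Q j) (s j))
               + (\<Sum>j\<in>cellJc G i. adjoint (opL Q j) (st j - s j))}"
      using F[OF i, of "f (pa G i)"] i parent_less[OF i] by (simp add: u f(2)[OF i])
  qed
  then show ?thesis by blast
qed

text \<open>Tree induction: equal values at the parent give equal dual outputs there, hence the same
  inclusion at the node, which has one solution.\<close>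

lemma is_prediction_unique:
  assumes zs: "(z, s) \<in> space_zs Q"
    and p: "is_prediction Q G M N z s u zt st" and p': "is_prediction Q G M N z s u' zt' st'"
  shows "u = u' \<and> zt = zt' \<and> st = st'"
proof -
  have s: "s j \<in> spK Q j" if "j \<in> {1..numB Q}" for j
    using zs that by (auto simp: space_zs_def)
  have st: "st j = st' j" if "u i = u' i" and i: "i < numA Q" "j \<in> cellJ G i" for i j
  proof -
    have "j \<in> {1..numB Q}"
      using cellJ_subset i by blast
    from ex1_unique[OF dual_ex1[OF this s[OF this], of "u' i"]
        is_prediction_dual[OF p i, unfolded that(1)] is_prediction_dual[OF p' i]]
    show ?thesis .
  qed
  have u: "u i = u' i" if "i < numA Q" for i
    using rooted that
  proof (induction rule: rooted_tree_induct)
    case root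
    from ex1_unique[OF root_ex1 is_prediction_root[OF p] is_prediction_root[OF p']]
    show ?case .
  next
    case (node i)
    have dual: "(\<Sum>j\<in>cellJc G i. adjoint (opL Q j) (st j - s j))
        = (\<Sum>j\<in>cellJc G i. adjoint (opL Q j) (st' j - s j))"
      using st[OF node(2) parent_less[OF node(1)]] cellJc_subset[OF node(1)] by (intro sum.cong) auto
    from ex1_unique[OF node_ex1[OF node(1)] is_prediction_node[OF p node(1), unfolded node(2) dual]
        is_prediction_node[OF p' node(1)]]
    show ?case .
  qed
  note mem = is_prediction_mem[OF p] and mem' = is_prediction_mem[OF p']
  have eq: "u = u'"
    by (rule PiE_ext[OF mem(1) mem'(1)]) (simp add: u)
  moreover have "zt = zt'"
    by (rule PiE_ext[OF mem(2) mem'(2)])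
      (simp add: is_prediction_zt[OF p] is_prediction_zt[OF p'] eq)
  moreover have "st = st'"
  proof (rule PiE_ext[OF mem(3) mem'(3)])
    fix j assume "j \<in> {1..numB Q}"
    then obtain i where "i < numA Q" "j \<in> cellJ G i"
      using cellJ_node by blast
    then show "st j = st' j" using st u by blast
  qed
  ultimately show ?thesis by blast
qed

lemma prediction_eqI:
  assumes "(z, s) \<in> space_zs Q" "is_prediction Q G M N z s u zt st"
  shows "prediction Q G M N (z, s) = (u, zt, st)"
  unfolding prediction_def prod.case
proof (rule the_equality)
  fix x assume x: "case x of (u, zt, st) \<Rightarrow> is_prediction Q G M N z s u zt st"
  obtain u' zt' st' where "x = (u', zt', st')" by (cases x)
  with x show "x = (u, zt, st)"
    using is_prediction_unique[OF assms(1) _ assms(2), of u' zt' st'] by simp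
qed (use assms in simp)

text \<open>After cancelling the inverse of the metric, the resolvent formula for the root value is
  the root inclusion rearranged.\<close>

lemma metric_resolvent_root:
  assumes "0 \<in> opA Q 0 u + {(\<Sum>c\<in>ch Q G 0. M c (u - z c)) + k - a}"
  shows "metric_resolvent (\<lambda>x. \<Sum>c\<in>ch Q G 0. M c x) (opA Q 0) ((\<Sum>c\<in>ch Q G 0. M c (z c)) - k + a) = u"
proof -
  let ?M = "\<lambda>x. \<Sum>c\<in>ch Q G 0. M c x" and ?y = "(\<Sum>c\<in>ch Q G 0. M c (z c)) - k + a"
  have "?y \<in> {?M v} + opA Q 0 v \<longleftrightarrow> 0 \<in> opA Q 0 v + {(\<Sum>c\<in>ch Q G 0. M c (v - z c)) + k - a}" for v
  proof -
    have "?y \<in> {?M v} + opA Q 0 v \<longleftrightarrow> ?y - ?M v \<in> opA Q 0 v"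
      by (force simp: set_plus_def)
    also have "?y - ?M v = - ((\<Sum>c\<in>ch Q G 0. M c (v - z c)) + k - a)"
      by (simp add: sum_M_diff)
    finally show ?thesis
      by (simp only: zero_in_plus_singleton)
  qed
  moreover have "linear ?M"
    using metric_root by (simp add: metric_on_UNIV bounded_linear.linear)
  ultimately show ?thesis
    using metric_resolvent_eq[OF _ metric_on_bij[OF metric_root]] the1_equality[OF root_ex1 assms]
    by simp
qed

section \<open>Predictions that reproduce their input\<close>

text \<open>The metric term vanishes when output equals input, leaving \<open>L x - b\<close> in the
  sum of the two inverses at \<open>s\<close>, which is membership in the parallel sum.\<close>

lemma dual_fixed_iff:
  assumes j: "j \<in> {1..numB Q}"
  shows "0 \<in> inverse_op (opB Q j) s + {N j (s - s)} + inverse_op (opD Q j) s + {- opL Q j x + vecB Q j}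
     \<longleftrightarrow> s \<in> parallel_sum (opB Q j) (opD Q j) (opL Q j x - vecB Q j)"
proof -
  have "inverse_op (opB Q j) s + {N j (s - s)} = inverse_op (opB Q j) s"
    by (simp add: metric_on_zero[OF metric_N[OF j] spK(1)[OF j]] set_plus_def)
  then show ?thesis
    by (simp add: zero_in_plus_singleton parallel_sum_def inverse_op_def[of "\<lambda>u. inverse_op _ u + inverse_op _ u"])
qed

lemma is_prediction_fixed_const:
  assumes "is_prediction Q G M N z s u z s"
  shows "u = (\<lambda>i\<in>{..<numA Q}. u 0)"
proof (rule PiE_ext[OF is_prediction_mem(1)[OF assms]])
  show "u i = (\<lambda>i\<in>{..<numA Q}. u 0) i" if "i \<in> {..<numA Q}" for i
  proof -
    have "i < numA Q" using that by simp
    with rooted have "u i = u 0"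
      by (induction rule: rooted_tree_induct) (use is_prediction_zt[OF assms] in auto)
    with that show ?thesis by simp
  qed
qed simp

text \<open>With all node values equal to \<open>x\<close> and \<open>g c = M c (x - z c)\<close>,
  this is the element that the inclusion of node \<open>i\<close> requires in
  \<open>opA Q i x\<close>. The edge term \<open>g\<close> acts as a flow: a node takes in
  \<open>g i\<close>, the root takes in \<open>vecA Q\<close>, and each child is handed its own
  term.\<close>

definition node_balance where
  "node_balance x g s i =
     (if i = 0 then vecA Q else g i) - (\<Sum>c\<in>ch Q G i. g c)
       - (\<Sum>l\<in>cellP G i. opC Q l x) - (\<Sum>j\<in>cellJ G i. adjoint (opL Q j) (s j))"

text \<open>Each edge term enters once at its node and once, with opposite sign, at the
  parent.\<close>

lemma sum_node_balance:
  "(\<Sum>i<numA Q. node_balance x g s i) =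
     vecA Q - (\<Sum>l\<in>{1..numC Q}. opC Q l x) - (\<Sum>j\<in>{1..numB Q}. adjoint (opL Q j) (s j))"
proof -
  have "(\<Sum>i<numA Q. if i = 0 then vecA Q else g i) = vecA Q + sum g {1..<numA Q}"
    unfolding nodes_split by (simp cong: sum.cong_simp)
  then show ?thesis
    by (simp add: node_balance_def sum_subtractf sum_ch cells_partition_sum[OF cellP, symmetric]
        cells_partition_sum[OF cellJ, symmetric] del: One_nat_def)
qed

lemma is_prediction_const_iff:
  assumes zs: "(z, s) \<in> space_zs Q"
  shows "is_prediction Q G M N z s (\<lambda>i\<in>{..<numA Q}. x) z s \<longleftrightarrow>
     (\<forall>i<numA Q. node_balance x (\<lambda>c. M c (x - z c)) s i \<in> opA Q i x) \<and>
     (\<forall>j\<in>{1..numB Q}. s j \<in> parallel_sum (opB Q j) (opD Q j) (opL Q j x - vecB Q j))"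
proof -
  let ?u = "\<lambda>i\<in>{..<numA Q}. x" and ?b = "node_balance x (\<lambda>c. M c (x - z c)) s"
  have root: "0 \<in> opA Q 0 (?u 0) + {(\<Sum>c\<in>ch Q G 0. M c (?u 0 - z c))
            + (\<Sum>j\<in>cellJ G 0. adjoint (opL Q j) (s j)) - vecA Q} \<longleftrightarrow> ?b 0 \<in> opA Q 0 x"
    using nodes by (simp add: zero_in_plus_singleton node_balance_def cellP_root algebra_simps)
  have dual: "(\<forall>i<numA Q. \<forall>j\<in>cellJ G i.
        0 \<in> inverse_op (opB Q j) (s j) + {N j (s j - s j)} + inverse_op (opD Q j) (s j)
            + {- opL Q j (?u i) + vecB Q j}) \<longleftrightarrow>
      (\<forall>j\<in>{1..numB Q}. s j \<in> parallel_sum (opB Q j) (opD Q j) (opL Q j x - vecB Q j))"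
  proof -
    have cells: "(\<forall>i<numA Q. \<forall>j\<in>cellJ G i. R i j) \<longleftrightarrow> (\<forall>j\<in>{1..numB Q}. P j)"
      if "\<And>i j. i < numA Q \<Longrightarrow> j \<in> cellJ G i \<Longrightarrow> R i j \<longleftrightarrow> P j" for R P
    proof -
      have "(\<Union>i<numA Q. cellJ G i) = {1..numB Q}"
        using cellJ by (simp add: cells_partition_def)
      then have "(\<forall>j\<in>{1..numB Q}. P j) \<longleftrightarrow> (\<forall>i<numA Q. \<forall>j\<in>cellJ G i. P j)"
        by blast
      with that show ?thesis by simp
    qed
    show ?thesis
    proof (rule cells)
      fix i j assume i: "i < numA Q" and "j \<in> cellJ G i"
      then have "j \<in> {1..numB Q}" using cellJ_subset by blast
      then show "0 \<in> inverse_op (opB Q j) (s j) + {N j (s j - s j)} + inverse_op (opD Q j) (s j)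
            + {- opL Q j (?u i) + vecB Q j} \<longleftrightarrow>
          s j \<in> parallel_sum (opB Q j) (opD Q j) (opL Q j x - vecB Q j)"
        using dual_fixed_iff[of j "s j" x] i by simp
    qed
  qed
  have node: "0 \<in> opA Q i (?u i)
            + {M i (?u i + z i - 2 *\<^sub>R ?u (pa G i))
               + (\<Sum>c\<in>ch Q G i. M c (?u i - z c))
               + (\<Sum>l\<in>cellP G i. opC Q l (?u (pa G i)))
               + (\<Sum>j\<in>cellJ G i. adjoint (opL Q j) (s j))
               + (\<Sum>j\<in>cellJc G i. adjoint (opL Q j) (s j - s j))} \<longleftrightarrow> ?b i \<in> opA Q i x"
    if i: "i \<in> {1..<numA Q}" for i
  proof -
    have "(\<Sum>j\<in>cellJc G i. adjoint (opL Q j) (s j - s j)) = 0"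
      using cellJc_subset[OF i] cellJ_subset[OF parent_less[OF i]] adjoint_zero
      by (intro sum.neutral) auto
    \<comment> \<open>With equal values at node and parent, the reflected argument
      \<open>u + z - 2 u\<close> collapses, which gives the edge term its sign.\<close>
    moreover have "M i (x + z i - 2 *\<^sub>R x) = - M i (x - z i)"
      using linear_neg[OF linear_M[OF i], of "x - z i"] by (simp add: scaleR_2)
    ultimately show ?thesis
      using i parent_less[OF i]
      by (simp add: zero_in_plus_singleton node_balance_def algebra_simps)
  qed
  have split: "(\<forall>i<numA Q. P i) \<longleftrightarrow> P 0 \<and> (\<forall>i\<in>{1..<numA Q}. P i)" for P
    using nodes_split by (metis insert_iff lessThan_iff)
  have "(\<forall>i\<in>{1..<numA Q}. z i = z i + ?u i - ?u (pa G i))"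
    using parent_less by simp
  moreover have "?u \<in> {..<numA Q} \<rightarrow>\<^sub>E UNIV" "z \<in> H_fam Q" "s \<in> K_fam Q"
    using zs by (auto simp: space_zs_def)
  ultimately show ?thesis
    unfolding is_prediction_def root dual split[of "\<lambda>i. ?b i \<in> opA Q i x"] using node by blast
qed

section \<open>Solutions of (P) and constant predictions\<close>

lemma solves_iff:
  "solves Q x \<longleftrightarrow> (\<exists>\<alpha> \<sigma>. (\<forall>i<numA Q. \<alpha> i \<in> opA Q i x) \<and>
     (\<forall>j\<in>{1..numB Q}. \<sigma> j \<in> parallel_sum (opB Q j) (opD Q j) (opL Q j x - vecB Q j)) \<and>
     vecA Q = (\<Sum>i<numA Q. \<alpha> i) + (\<Sum>j\<in>{1..numB Q}. adjoint (opL Q j) (\<sigma> j))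
       + (\<Sum>l\<in>{1..numC Q}. opC Q l x))" (is "_ \<longleftrightarrow> ?r")
proof
  let ?P = "\<lambda>j. parallel_sum (opB Q j) (opD Q j) (opL Q j x - vecB Q j)"
  note sets = set_sum_alt[OF finite_lessThan] set_sum_alt[OF finite_atLeastAtMost]
  {
    assume "solves Q x"
    then obtain y y' where "y \<in> (\<Sum>i<numA Q. opA Q i x)"
      "y' \<in> (\<Sum>j\<in>{1..numB Q}. adjoint (opL Q j) ` ?P j)"
      and sum: "vecA Q = y + y' + (\<Sum>l\<in>{1..numC Q}. opC Q l x)"
      unfolding solves_def by (elim set_plus_elim) (simp only: singleton_iff)
    then obtain \<alpha> \<tau> where "\<forall>i\<in>{..<numA Q}. \<alpha> i \<in> opA Q i x"
      and \<tau>: "\<forall>j\<in>{1..numB Q}. \<tau> j \<in> adjoint (opL Q j) ` ?P j"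
      and "y = sum \<alpha> {..<numA Q}" "y' = sum \<tau> {1..numB Q}"
      unfolding sets by blast
    \<comment> \<open>Elements of the images under the adjoints are pulled back to dual variables
      \<open>\<sigma> j\<close>.\<close>
    from \<tau> have "\<forall>j\<in>{1..numB Q}. \<exists>t. t \<in> ?P j \<and> \<tau> j = adjoint (opL Q j) t" by blast
    then obtain \<sigma> where \<sigma>: "\<forall>j\<in>{1..numB Q}. \<sigma> j \<in> ?P j \<and> \<tau> j = adjoint (opL Q j) (\<sigma> j)"
      by (rule bchoice[THEN exE])
    then have "sum \<tau> {1..numB Q} = (\<Sum>j\<in>{1..numB Q}. adjoint (opL Q j) (\<sigma> j))"
      by (intro sum.cong) auto
    with \<sigma> sum \<open>\<forall>i\<in>{..<numA Q}. \<alpha> i \<in> opA Q i x\<close> \<open>y = sum \<alpha> {..<numA Q}\<close> \<open>y' = sum \<tau> {1..numB Q}\<close>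
    show ?r by (intro exI[of _ \<alpha>] exI[of _ \<sigma>]) simp
  }
  assume ?r
  then obtain \<alpha> \<sigma> where "\<forall>i<numA Q. \<alpha> i \<in> opA Q i x" "\<forall>j\<in>{1..numB Q}. \<sigma> j \<in> ?P j"
    and a: "vecA Q = (\<Sum>i<numA Q. \<alpha> i) + (\<Sum>j\<in>{1..numB Q}. adjoint (opL Q j) (\<sigma> j))
       + (\<Sum>l\<in>{1..numC Q}. opC Q l x)"
    by blast
  then have "(\<Sum>i<numA Q. \<alpha> i) \<in> (\<Sum>i<numA Q. opA Q i x)"
    "(\<Sum>j\<in>{1..numB Q}. adjoint (opL Q j) (\<sigma> j)) \<in> (\<Sum>j\<in>{1..numB Q}. adjoint (opL Q j) ` ?P j)"
    unfolding sets by blast+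
  then show "solves Q x"
    unfolding solves_def by (subst a) (intro set_plus_intro singletonI)
qed

lemma prediction_const_solves:
  assumes zs: "(z, s) \<in> space_zs Q" and p: "is_prediction Q G M N z s (\<lambda>i\<in>{..<numA Q}. x) z s"
  shows "solves Q x"
  unfolding solves_iff
proof (intro exI conjI)
  let ?b = "node_balance x (\<lambda>c. M c (x - z c)) s"
  show "\<forall>i<numA Q. ?b i \<in> opA Q i x"
    "\<forall>j\<in>{1..numB Q}. s j \<in> parallel_sum (opB Q j) (opD Q j) (opL Q j x - vecB Q j)"
    using p is_prediction_const_iff[OF zs] by auto
  show "vecA Q = (\<Sum>i<numA Q. ?b i) + (\<Sum>j\<in>{1..numB Q}. adjoint (opL Q j) (s j))
       + (\<Sum>l\<in>{1..numC Q}. opC Q l x)"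
    by (simp add: sum_node_balance)
qed

lemma solves_prediction_const:
  assumes "solves Q x"
  shows "\<exists>s\<in>K_fam Q. \<exists>w\<in>H_fam Q. is_prediction Q G M N (\<lambda>i\<in>{1..<numA Q}. x - w i) s
     (\<lambda>i\<in>{..<numA Q}. x) (\<lambda>i\<in>{1..<numA Q}. x - w i) s"
proof -
  obtain \<alpha> \<sigma> where \<alpha>: "\<forall>i<numA Q. \<alpha> i \<in> opA Q i x"
    and \<sigma>: "\<forall>j\<in>{1..numB Q}. \<sigma> j \<in> parallel_sum (opB Q j) (opD Q j) (opL Q j x - vecB Q j)"
    and a: "vecA Q = (\<Sum>i<numA Q. \<alpha> i) + (\<Sum>j\<in>{1..numB Q}. adjoint (opL Q j) (\<sigma> j))
       + (\<Sum>l\<in>{1..numC Q}. opC Q l x)"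
    using assms solves_iff by auto
  define s where "s = restrict \<sigma> {1..numB Q}"
  have s_par: "\<forall>j\<in>{1..numB Q}. s j \<in> parallel_sum (opB Q j) (opD Q j) (opL Q j x - vecB Q j)"
    using \<sigma> by (simp add: s_def)
  have "s j \<in> spK Q j" if j: "j \<in> {1..numB Q}" for j
    using s_par[rule_format, OF j] maximally_monotone_on_operator[OF opB[OF j]]
    by (auto simp: parallel_sum_def inverse_op_def set_plus_def)
  then have s: "s \<in> K_fam Q" by (auto simp: s_def)
  \<comment> \<open>This is the equation \<open>node_balance x g s i = \<alpha> i\<close> solved for
    \<open>g i\<close>, using only the values at the children.\<close>
  obtain g where g: "g i = \<alpha> i + (\<Sum>c\<in>ch Q G i. g c)
      + (\<Sum>l\<in>cellP G i. opC Q l x) + (\<Sum>j\<in>cellJ G i. adjoint (opL Q j) (s j))" for i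
    using rooted_tree_bottom_up[OF rooted, of "\<lambda>i g. \<alpha> i + (\<Sum>c\<in>ch Q G i. g c)
      + (\<Sum>l\<in>cellP G i. opC Q l x) + (\<Sum>j\<in>cellJ G i. adjoint (opL Q j) (s j))"]
    by (auto simp: ch_def cong: sum.cong_simp)
  \<comment> \<open>\<open>M i\<close> is bijective, so every prescribed edge term
    \<open>g i\<close> is attained as \<open>M i (x - z i)\<close> with
    \<open>z i = x - w i\<close>.\<close>
  define w where "w = (\<lambda>i\<in>{1..<numA Q}. inv (M i) (g i))"
  define z where "z = (\<lambda>i\<in>{1..<numA Q}. x - w i)"
  have w: "M i (x - z i) = g i" if "i \<in> {1..<numA Q}" for i
    using that metric_on_bij[OF metric_M[OF that]] by (simp add: z_def w_def bij_is_surj surj_f_inv_f)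
  let ?b = "node_balance x (\<lambda>c. M c (x - z c)) s"
  have node: "?b i = \<alpha> i" if i: "i \<in> {1..<numA Q}" for i
  proof -
    have "(\<Sum>c\<in>ch Q G i. M c (x - z c)) = (\<Sum>c\<in>ch Q G i. g c)"
      by (intro sum.cong refl w subsetD[OF ch_subset])
    then show ?thesis
      using i g[of i] w[OF i] by (simp add: node_balance_def)
  qed
  \<comment> \<open>No unknown remains to adjust the balance at the root; it is correct because the
    totals agree and all other nodes match.\<close>
  have "sum ?b {..<numA Q} = sum \<alpha> {..<numA Q}"
    unfolding sum_node_balance by (subst a) (simp add: s_def)
  moreover have "sum ?b {1..<numA Q} = sum \<alpha> {1..<numA Q}"
    using node by (rule sum.cong[OF refl])
  ultimately have "?b 0 = \<alpha> 0"
    by (simp add: nodes_split)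
  with node \<alpha> have "\<forall>i<numA Q. ?b i \<in> opA Q i x"
    using nodes_split by (metis insert_iff lessThan_iff)
  moreover have "(z, s) \<in> space_zs Q"
    using s by (simp add: space_zs_def z_def)
  ultimately have "is_prediction Q G M N z s (\<lambda>i\<in>{..<numA Q}. x) z s"
    using s_par is_prediction_const_iff by blast
  moreover have "w \<in> H_fam Q" by (simp add: w_def)
  ultimately show ?thesis
    using s unfolding z_def by blast
qed

end

section \<open>Relaxation and the fixed point correspondence\<close>

text \<open>A nonzero factor does not change where an increment vanishes, and extensionality lifts
  the pointwise equalities to families.\<close>

lemma relax_eq_iff:
  assumes "z \<in> H_fam Q" "s \<in> K_fam Q" "zt \<in> H_fam Q" "st \<in> K_fam Q"
    and "\<And>i. i \<in> {1..<numA Q} \<Longrightarrow> \<theta> i \<noteq> 0" "\<And>j. j \<in> {1..numB Q} \<Longrightarrow> \<zeta> j \<noteq> 0"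
  shows "relax Q \<theta> \<zeta> (z, s) (zt, st) = (z, s) \<longleftrightarrow> zt = z \<and> st = s"
proof
  assume eq: "relax Q \<theta> \<zeta> (z, s) (zt, st) = (z, s)"
  have "zt i = z i" if i: "i \<in> {1..<numA Q}" for i
  proof -
    have "(\<lambda>i\<in>{1..<numA Q}. z i + \<theta> i *\<^sub>R (zt i - z i)) i = z i"
      using eq by (simp only: relax_def prod.case prod.inject)
    then show ?thesis using i assms(5)[OF i] by simp
  qed
  moreover have "st j = s j" if j: "j \<in> {1..numB Q}" for j
  proof -
    have "(\<lambda>j\<in>{1..numB Q}. s j + \<zeta> j *\<^sub>R (st j - s j)) j = s j"
      using eq by (simp only: relax_def prod.case prod.inject)
    then show ?thesis using j assms(6)[OF j] by simp
  qed
  ultimately show "zt = z \<and> st = s"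
    using PiE_ext[OF assms(3,1)] PiE_ext[OF assms(4,2)] by blast
next
  assume "zt = z \<and> st = s"
  then show "relax Q \<theta> \<zeta> (z, s) (zt, st) = (z, s)"
    using assms(1,2) by (simp add: relax_def PiE_restrict)
qed

theorem proposition3p2:
  fixes Q :: "('h::{real_inner,complete_space}, 'k::real_inner) problem"
    and G :: tree_data
    and M :: "nat \<Rightarrow> 'h \<Rightarrow> 'h" and N :: "nat \<Rightarrow> 'k \<Rightarrow> 'k"
    and \<theta> \<zeta> :: "nat \<Rightarrow> real"
  assumes "valid_problem Q"
    and "valid_tree Q G"
    and "valid_metrics Q M N"
    and "\<And>i. i \<in> {1..<numA Q} \<Longrightarrow> \<theta> i \<noteq> 0"
    and "\<And>j. j \<in> {1..numB Q} \<Longrightarrow> \<zeta> j \<noteq> 0"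
  shows
    "(\<forall>z s. (z, s) \<in> Fix (space_zs Q) (T_zs_relaxed Q G M N \<theta> \<zeta>) \<longrightarrow>
        (let u\<^sub>0 = metric_resolvent (\<lambda>x. \<Sum>c\<in>ch Q G 0. M c x) (opA Q 0)
                   ((\<Sum>c\<in>ch Q G 0. M c (z c)) - (\<Sum>j\<in>cellJ G 0. adjoint (opL Q j) (s j)) + vecA Q)
         in (u\<^sub>0, (\<lambda>i\<in>{1..<numA Q}. u\<^sub>0), z, s) \<in> Fix (space_uzs Q) (T_uzs_relaxed Q G M N \<theta> \<zeta>) \<and>
            solves Q u\<^sub>0))
     \<and>
     (\<forall>u. solves Q u \<longrightarrow>
        (\<exists>s \<in> K_fam Q. \<exists>w \<in> H_fam Q.
           (u, (\<lambda>i\<in>{1..<numA Q}. u), (\<lambda>i\<in>{1..<numA Q}. u - w i), s)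
              \<in> Fix (space_uzs Q) (T_uzs_relaxed Q G M N \<theta> \<zeta>) \<and>
           ((\<lambda>i\<in>{1..<numA Q}. u - w i), s) \<in> Fix (space_zs Q) (T_zs_relaxed Q G M N \<theta> \<zeta>)))"
proof -
  interpret splitting Q G M N
    by unfold_locales fact+
  have fixed: "(x, (\<lambda>i\<in>{1..<numA Q}. x), z, s) \<in> Fix (space_uzs Q) (T_uzs_relaxed Q G M N \<theta> \<zeta>)"
    "(z, s) \<in> Fix (space_zs Q) (T_zs_relaxed Q G M N \<theta> \<zeta>)"
    if zs: "(z, s) \<in> space_zs Q" and p: "is_prediction Q G M N z s (\<lambda>i\<in>{..<numA Q}. x) z s" for x z s
  proof -
    \<comment> \<open>The state carries the root value separately from the family over
      \<open>{1..<numA Q}\<close>, so the constant family is restricted twice.\<close>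
    have "{..<numA Q} \<inter> {1..<numA Q} = {1..<numA Q}" "0 < numA Q"
      using nodes by auto
    moreover have "z \<in> H_fam Q" "s \<in> K_fam Q"
      using zs by (auto simp: space_zs_def)
    moreover have "relax Q \<theta> \<zeta> (z, s) (z, s) = (z, s)"
      using relax_eq_iff[of z Q s z s] assms(4,5) \<open>z \<in> H_fam Q\<close> \<open>s \<in> K_fam Q\<close> by blast
    ultimately show "(x, (\<lambda>i\<in>{1..<numA Q}. x), z, s) \<in> Fix (space_uzs Q) (T_uzs_relaxed Q G M N \<theta> \<zeta>)"
      "(z, s) \<in> Fix (space_zs Q) (T_zs_relaxed Q G M N \<theta> \<zeta>)"
      using zs by (simp_all add: Fix_def space_uzs_def T_uzs_relaxed_def T_uzs_def T_zs_relaxed_def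
          T_zs_def prediction_eqI[OF zs p])
  qed
  show ?thesis
  proof (intro conjI allI impI)
    fix z s assume fix_zs: "(z, s) \<in> Fix (space_zs Q) (T_zs_relaxed Q G M N \<theta> \<zeta>)"
    then have zs: "(z, s) \<in> space_zs Q" by (simp add: Fix_def)
    obtain u zt st where p: "is_prediction Q G M N z s u zt st"
      using is_prediction_ex[OF zs] by blast
    have "relax Q \<theta> \<zeta> (z, s) (zt, st) = (z, s)"
      using fix_zs by (simp add: Fix_def T_zs_relaxed_def T_zs_def prediction_eqI[OF zs p])
    then have "zt = z \<and> st = s"
      using relax_eq_iff[of z Q s zt st] is_prediction_mem[OF p] zs assms(4,5)
      by (auto simp: space_zs_def)
    with p have p: "is_prediction Q G M N z s u z s" by simp
    have u: "is_prediction Q G M N z s (\<lambda>i\<in>{..<numA Q}. u 0) z s"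
      using p is_prediction_fixed_const[OF p] by simp
    show "let u\<^sub>0 = metric_resolvent (\<lambda>x. \<Sum>c\<in>ch Q G 0. M c x) (opA Q 0)
                   ((\<Sum>c\<in>ch Q G 0. M c (z c)) - (\<Sum>j\<in>cellJ G 0. adjoint (opL Q j) (s j)) + vecA Q)
         in (u\<^sub>0, (\<lambda>i\<in>{1..<numA Q}. u\<^sub>0), z, s) \<in> Fix (space_uzs Q) (T_uzs_relaxed Q G M N \<theta> \<zeta>) \<and>
            solves Q u\<^sub>0"
      \<comment> \<open>The root inclusion identifies the resolvent expression with
        \<open>u 0\<close>.\<close>
      unfolding Let_def metric_resolvent_root[OF is_prediction_root[OF p]]
      using fixed(1)[OF zs u] prediction_const_solves[OF zs u] by blast
  next
    fix x assume "solves Q x"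
    then obtain s w where "s \<in> K_fam Q" "w \<in> H_fam Q"
      and p: "is_prediction Q G M N (\<lambda>i\<in>{1..<numA Q}. x - w i) s
        (\<lambda>i\<in>{..<numA Q}. x) (\<lambda>i\<in>{1..<numA Q}. x - w i) s"
      using solves_prediction_const by blast
    moreover from this have "((\<lambda>i\<in>{1..<numA Q}. x - w i), s) \<in> space_zs Q"
      by (simp add: space_zs_def)
    ultimately show "\<exists>s \<in> K_fam Q. \<exists>w \<in> H_fam Q.
           (x, (\<lambda>i\<in>{1..<numA Q}. x), (\<lambda>i\<in>{1..<numA Q}. x - w i), s)
              \<in> Fix (space_uzs Q) (T_uzs_relaxed Q G M N \<theta> \<zeta>) \<and>
           ((\<lambda>i\<in>{1..<numA Q}. x - w i), s) \<in> Fix (space_zs Q) (T_zs_relaxed Q G M N \<theta> \<zeta>)"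
      using fixed[OF _ p] by blast
  qed
qed

end
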